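(* Let $n \ge 2$, let $S \subset \mathbb{C}$ be a bounded domain, and let $A(\mathbb{C}^n)$ denote the set of complex affine $(n-1)$-dimensional subspaces of $\mathbb{C}^n$. Then there does not exist a map $f : S \to A(\mathbb{C}^n)$ satisfying all of the following conditions, where $W_t := f(t) \cap \mathbb{B}^n$ for $t \in S$: (1) $\mathbb{B}^n = \bigcup_{t \in S} W_t$. (2) For all $s, t \in S$, either $W_t \cap W_s = \emptyset$ or $W_s = W_t$. (3) There is a holomorphic map $\pi : \mathbb{B}^n \to \mathbb{B}^{n-1}$ such that the restriction $\pi|_{W_t} : W_t \to \mathbb{B}^{n-1}$ is bijective for all $t \in S$.
   Context: $\mathbb{B}^k$ denotes the open unit ball in $\mathbb{C}^k$. No continuity or other regularity of the map $f$ is assumed. *)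

theory Defs
  imports "HOL-Analysis.Analysis"
begin

text \<open>
  \<open>complex ^ 'n\<close> models \<open>n\<close>-dimensional complex space for \<open>n = CARD('n)\<close>. Its norm is the Hermitian
  one, so \<open>ball 0 1\<close> is the open unit ball.
\<close>

text \<open>
  Complex affine subspaces of codimension one. The constants prefixed by \<open>vec\<close> refer to the
  complex vector space structure with scalar multiplication \<open>*s\<close>, whereas the unprefixed
  \<open>subspace\<close>, \<open>dim\<close>, \<open>affine\<close> and \<open>aff_dim\<close> are the real notions.
\<close>

definition complex_affine_hyperplanes :: "(complex ^ 'n) set set" where
  "complex_affine_hyperplanes =
     {(\<lambda>v. a + v) ` V | a V. vec.subspace V \<and> vec.dim V = CARD('n) - 1}"

text \<open>
  Holomorphy in several variables as Frechet differentiability with a complex-linear derivative;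
  meant for open \<open>U\<close>.
\<close>

definition holomorphic_map_on :: "(complex ^ 'n \<Rightarrow> complex ^ 'm) \<Rightarrow> (complex ^ 'n) set \<Rightarrow> bool" where
  "holomorphic_map_on F U \<longleftrightarrow>
     (\<forall>z\<in>U. \<exists>D. (F has_derivative D) (at z) \<and> Vector_Spaces.linear (*s) (*s) D)"

end

theory Submission
  imports Defs "HOL-Complex_Analysis.Complex_Analysis"
begin

text \<open>
  The restriction of \<open>\<pi>\<close> to a leaf is a holomorphic bijection between balls, hence an isometry for the
  Bergman metrics, whereas \<open>\<pi>\<close> itself contracts them. Therefore the kernel of the derivative of \<open>\<pi>\<close> at
  a point \<open>q\<close> is the Bergman normal to the leaf through \<open>q\<close>: if the leaf has Euclidean normal
  \<open>N\<close>, this is the line spanned by \<open>N - \<langle>N, q\<rangle> q\<close>. So the Bergman normals of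
  the leaves form a holomorphic line field. Let \<open>\<nu>\<close> be the unit normal of the leaf through \<open>0\<close> and
  \<open>e\<close> a unit vector in this leaf. Near \<open>0\<close> the kernel is spanned by \<open>\<sigma> + \<nu>\<close> with \<open>\<sigma>\<close>
  holomorphic and orthogonal to \<open>\<nu>\<close>; let \<open>s = \<langle>\<sigma>, e\<rangle>\<close>. On the leaf through \<open>\<alpha>\<nu>\<close>, the points of the
  plane spanned by \<open>e\<close> and \<open>\<nu>\<close> are \<open>z e + (\<alpha> + \<beta>z) \<nu>\<close> for some \<open>\<beta>\<close>, and there
  \<open>s = - (\<beta>' + \<alpha>' z) / (1 - \<alpha>' (\<alpha> + \<beta>z))\<close>, where the prime is complex conjugation. The value and the
  first derivative at \<open>z = 0\<close> eliminate \<open>\<beta>\<close> and leave an identity between \<open>S(\<alpha>) = s(\<alpha>\<nu>)\<close> and the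
  holomorphic function \<open>g(\<alpha>) = \<partial>\<^sub>e s(\<alpha>\<nu>)\<close> that contradicts the Cauchy--Riemann equations at third
  order in \<open>\<alpha>\<close>.
\<close>

subsection \<open>The Hermitian inner product and holomorphic functions of several variables\<close>

definition herm :: "complex ^ 'n \<Rightarrow> complex ^ 'n \<Rightarrow> complex" where
  "herm x y = (\<Sum>i\<in>UNIV. x $ i * cnj (y $ i))"

lemma herm_add_left: "herm (x + y) z = herm x z + herm y z"
  and herm_add_right: "herm x (y + z) = herm x y + herm x z"
  and herm_diff_left: "herm (x - y) z = herm x z - herm y z"
  and herm_diff_right: "herm x (y - z) = herm x y - herm x z"
  and herm_minus_left: "herm (- x) y = - herm x y"
  and herm_minus_right: "herm x (- y) = - herm x y"
  and herm_scale_left: "herm (c *s x) y = c * herm x y"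
  and herm_scale_right: "herm x (c *s y) = cnj c * herm x y"
  and herm_zero_left: "herm 0 x = 0"
  and herm_zero_right: "herm x 0 = 0"
  by (simp_all add: herm_def algebra_simps sum.distrib sum_subtractf sum_negf sum_distrib_left)

lemmas herm_simps = herm_add_left herm_add_right herm_diff_left herm_diff_right
  herm_minus_left herm_minus_right herm_scale_left herm_scale_right herm_zero_left herm_zero_right

lemma cnj_herm: "cnj (herm x y) = herm y x"
  by (simp add: herm_def mult.commute)

lemma inner_eq_Re_herm: "inner x y = Re (herm x y)"
  by (simp add: herm_def inner_vec_def inner_complex_def Re_sum)

lemma herm_self: "herm x x = of_real ((norm x)\<^sup>2)"
proof -
  have "Re (herm x x) = (norm x)\<^sup>2"
    by (metis inner_eq_Re_herm power2_norm_eq_inner)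
  moreover have "Im (herm x x) = - Im (herm x x)"
    by (metis cnj.simps(2) cnj_herm)
  ultimately show ?thesis by (simp add: complex_eq_iff)
qed

lemma norm_vec_scale: "norm (c *s x) = cmod c * norm (x :: complex ^ 'n)"
proof -
  have "of_real ((norm (c *s x))\<^sup>2) = (of_real ((cmod c * norm x)\<^sup>2) :: complex)"
    unfolding herm_self[symmetric] herm_simps
    using complex_norm_square[of c] by (simp add: herm_self power_mult_distrib mult_ac)
  hence "(norm (c *s x))\<^sup>2 = (cmod c * norm x)\<^sup>2" by (metis of_real_eq_iff)
  thus ?thesis by (simp add: power2_eq_iff_nonneg)
qed

lemma scaleR_eq_vec_scale: "r *\<^sub>R x = of_real r *s (x :: complex ^ 'n)"
  by (simp add: vec_eq_iff, simp add: scaleR_conv_of_real)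

lemma herm_scaleR_left: "herm (r *\<^sub>R x) y = of_real r * herm x y"
  by (simp add: scaleR_eq_vec_scale herm_simps)

text \<open>A unimodular factor \<open>c\<close> makes the product real and nonnegative, which
  reduces the Hermitian Cauchy--Schwarz inequality to the real one.\<close>

lemma cmod_herm_le: "cmod (herm x y) \<le> norm x * norm y"
proof (cases "herm x y = 0")
  case False
  define c where "c = cnj (herm x y) / cmod (herm x y)"
  have c: "cmod c = 1" using False by (simp add: c_def norm_divide)
  have "c * herm x y = of_real (cmod (herm x y))"
    using False complex_norm_square[of "herm x y"]
    by (simp add: c_def mult.commute[of "cnj _"] power2_eq_square nonzero_divide_eq_eq)
  hence "cmod (herm x y) = inner (c *s x) y"
    by (simp add: inner_eq_Re_herm herm_simps)
  also have "\<dots> \<le> norm (c *s x) * norm y" by (rule norm_cauchy_schwarz)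
  finally show ?thesis by (simp add: norm_vec_scale c)
qed simp

lemma bounded_linear_herm: "bounded_linear (\<lambda>x. herm x y)"
proof (rule bounded_linear_intro[where K = "norm y"])
  show "norm (herm x y) \<le> norm x * norm y" for x
    by (rule cmod_herm_le)
qed (simp_all add: herm_simps herm_scaleR_left scaleR_conv_of_real[where 'a = complex])

lemma bounded_linear_vec_scale_left: "bounded_linear (\<lambda>c. c *s (x :: complex ^ 'n))"
proof (rule bounded_linear_intro[where K = "norm x"])
  show "norm (c *s x) \<le> norm c * norm x" for c
    by (simp add: norm_vec_scale)
qed (simp_all add: vec.scale_left_distrib scaleR_eq_vec_scale scaleR_conv_of_real)

lemma bounded_linear_vec_scale_right: "bounded_linear (\<lambda>x. c *s (x :: complex ^ 'n))"
proof (rule bounded_linear_intro[where K = "cmod c"])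
  show "norm (c *s x) \<le> norm x * cmod c" for x
    by (simp add: norm_vec_scale)
qed (simp_all add: vec.scale_right_distrib scaleR_eq_vec_scale mult.commute)

lemmas continuous_on_herm [continuous_intros] =
  bounded_linear.continuous_on[OF bounded_linear_herm]
lemmas continuous_on_vec_scale_left [continuous_intros] =
  bounded_linear.continuous_on[OF bounded_linear_vec_scale_left]
lemmas has_derivative_herm [derivative_intros] =
  bounded_linear.has_derivative[OF bounded_linear_herm]
lemmas has_derivative_vec_scale_left [derivative_intros] =
  bounded_linear.has_derivative[OF bounded_linear_vec_scale_left]
lemmas has_derivative_vec_scale_right [derivative_intros] =
  bounded_linear.has_derivative[OF bounded_linear_vec_scale_right]

text \<open>A Frechet derivative is already additive and real-homogeneous, so complex linearity
  comes down to complex homogeneity.\<close>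

definition has_cderiv ::
    "(complex ^ 'n \<Rightarrow> complex) \<Rightarrow> (complex ^ 'n \<Rightarrow> complex) \<Rightarrow> complex ^ 'n \<Rightarrow> bool" where
  "has_cderiv f D z \<longleftrightarrow> (f has_derivative D) (at z) \<and> (\<forall>c v. D (c *s v) = c * D v)"

definition chol :: "(complex ^ 'n \<Rightarrow> complex) \<Rightarrow> (complex ^ 'n) set \<Rightarrow> bool" where
  "chol f U \<longleftrightarrow> (\<forall>z\<in>U. \<exists>D. has_cderiv f D z)"

text \<open>The direction precedes the point so that \<open>pd f v\<close> is again a function of
  the point and can itself be differentiated.\<close>

definition pd :: "(complex ^ 'n \<Rightarrow> complex) \<Rightarrow> complex ^ 'n \<Rightarrow> complex ^ 'n \<Rightarrow> complex" where
  "pd f v p = frechet_derivative f (at p) v"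

lemma cholD:
  assumes "chol f U" "z \<in> U"
  shows "(f has_derivative (\<lambda>v. pd f v z)) (at z)" "pd f (c *s v) z = c * pd f v z"
proof -
  obtain D where D: "(f has_derivative D) (at z)" "\<And>c v. D (c *s v) = c * D v"
    using assms by (auto simp: chol_def has_cderiv_def)
  have "D = (\<lambda>v. pd f v z)"
    unfolding pd_def using frechet_derivative_at[OF D(1)] by auto
  thus "(f has_derivative (\<lambda>v. pd f v z)) (at z)" "pd f (c *s v) z = c * pd f v z"
    using D by simp_all
qed

lemma pd_add:
  assumes "chol f U" "z \<in> U"
  shows "pd f (u + v) z = pd f u z + pd f v z"
  using linear_add[OF has_derivative_linear[OF cholD(1)[OF assms]]] .

lemma pd_eqI: "(f has_derivative D) (at p) \<Longrightarrow> pd f v p = D v"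
  unfolding pd_def by (metis frechet_derivative_at)

lemma chol_subset: "chol f U \<Longrightarrow> V \<subseteq> U \<Longrightarrow> chol f V"
  by (auto simp: chol_def)

lemma chol_continuous_on: "chol f U \<Longrightarrow> continuous_on U f"
  by (meson cholD(1) continuous_at_imp_continuous_on has_derivative_continuous)

lemma chol_const: "chol (\<lambda>z. c) U"
  unfolding chol_def has_cderiv_def by (intro ballI exI[of _ "\<lambda>_. 0"]) auto

lemma chol_add:
  assumes "chol f U" "chol g U" shows "chol (\<lambda>z. f z + g z) U"
  unfolding chol_def has_cderiv_def
proof (intro ballI exI conjI allI)
  fix z assume z: "z \<in> U"
  show "((\<lambda>z. f z + g z) has_derivative (\<lambda>v. pd f v z + pd g v z)) (at z)"
    by (intro has_derivative_add cholD[OF assms(1) z] cholD[OF assms(2) z])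
  show "pd f (c *s v) z + pd g (c *s v) z = c * (pd f v z + pd g v z)" for c v
    by (simp add: cholD[OF assms(1) z] cholD[OF assms(2) z] algebra_simps)
qed

lemma chol_mult:
  assumes "chol f U" "chol g U" shows "chol (\<lambda>z. f z * g z) U"
  unfolding chol_def has_cderiv_def
proof (intro ballI exI conjI allI)
  fix z assume z: "z \<in> U"
  show "((\<lambda>z. f z * g z) has_derivative (\<lambda>v. f z * pd g v z + pd f v z * g z)) (at z)"
    by (intro has_derivative_mult cholD[OF assms(1) z] cholD[OF assms(2) z])
  show "f z * pd g (c *s v) z + pd f (c *s v) z * g z = c * (f z * pd g v z + pd f v z * g z)" for c v
    by (simp add: cholD[OF assms(1) z] cholD[OF assms(2) z] algebra_simps)
qed

lemma chol_cmult: "chol f U \<Longrightarrow> chol (\<lambda>z. c * f z) U"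
  by (intro chol_mult chol_const)

lemma chol_uminus: "chol f U \<Longrightarrow> chol (\<lambda>z. - f z) U"
  using chol_cmult[of f U "-1"] by simp

lemma chol_sum: "(\<And>i. i \<in> I \<Longrightarrow> chol (f i) U) \<Longrightarrow> chol (\<lambda>z. \<Sum>i\<in>I. f i z) U"
  by (induction I rule: infinite_finite_induct) (auto intro: chol_add chol_const)

lemma chol_prod: "(\<And>i. i \<in> I \<Longrightarrow> chol (f i) U) \<Longrightarrow> chol (\<lambda>z. \<Prod>i\<in>I. f i z) U"
  by (induction I rule: infinite_finite_induct) (auto intro: chol_mult chol_const)

text \<open>Serves Jacobian determinants and Cramer's rule, by which the solution of a linear system
  depends holomorphically on its coefficients.\<close>

lemma chol_det:
  fixes M :: "complex ^ 'n \<Rightarrow> complex ^ 'm ^ 'm"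
  assumes "\<And>i j. chol (\<lambda>z. (M z $ i) $ j) U"
  shows "chol (\<lambda>z. det (M z)) U"
  unfolding det_def by (intro chol_sum chol_mult chol_const chol_prod assms)

lemma chol_inverse:
  assumes "chol f U" "\<And>z. z \<in> U \<Longrightarrow> f z \<noteq> 0" shows "chol (\<lambda>z. inverse (f z)) U"
  unfolding chol_def has_cderiv_def
proof (intro ballI exI conjI allI)
  fix z assume z: "z \<in> U"
  show "((\<lambda>z. inverse (f z)) has_derivative (\<lambda>v. - (inverse (f z) * pd f v z * inverse (f z)))) (at z)"
    by (intro Deriv.has_derivative_inverse cholD[OF assms(1) z] assms(2) z)
  show "- (inverse (f z) * pd f (c *s v) z * inverse (f z)) = c * - (inverse (f z) * pd f v z * inverse (f z))" for c v
    by (simp add: cholD[OF assms(1) z] algebra_simps)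
qed

lemma chol_divide:
  assumes "chol f U" "chol g U" "\<And>z. z \<in> U \<Longrightarrow> g z \<noteq> 0" shows "chol (\<lambda>z. f z / g z) U"
  unfolding divide_inverse by (intro chol_mult chol_inverse assms)

lemma chol_has_field_derivative:
  assumes "chol f U" "g t \<in> U" "(g has_derivative (\<lambda>h. h *s w)) (at t)"
  shows "((\<lambda>t. f (g t)) has_field_derivative pd f w (g t)) (at t)"
proof -
  have "((\<lambda>t. f (g t)) has_derivative (\<lambda>h. pd f (h *s w) (g t))) (at t)"
    using has_derivative_compose[OF assms(3) cholD(1)[OF assms(1,2)]] .
  thus ?thesis
    unfolding has_field_derivative_def cholD(2)[OF assms(1,2)]
    by (simp add: mult.commute[of _ "pd _ _ _"] )
qed

lemma affine_line_has_derivative: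
  "((\<lambda>h. p + h *s (v :: complex ^ 'n)) has_derivative (\<lambda>h. h *s v)) (at t)"
  by (auto intro!: derivative_eq_intros)

section \<open>Cauchy's integral formula: directional derivatives of holomorphic functions are
  holomorphic\<close>

lemma pd_integral:
  fixes f :: "complex ^ 'n \<Rightarrow> complex" and \<rho> :: real
  assumes f: "chol f U" and \<rho>: "\<rho> > 0" and sub: "\<And>c. cmod c \<le> \<rho> \<Longrightarrow> p + c *s v \<in> U"
  shows "pd f v p = integral {0..1::real} (\<lambda>t. f (p + (\<rho> * exp (2 * of_real pi * \<i> * t)) *s v) * inverse (\<rho> * exp (2 * of_real pi * \<i> * t)))"
proof -
  define k where "k = (\<lambda>c. f (p + c *s v))"
  have dk: "(k has_field_derivative pd f v (p + c *s v)) (at c)" if "cmod c \<le> \<rho>" for c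
    unfolding k_def
    by (rule chol_has_field_derivative[OF f sub[OF that] affine_line_has_derivative])
  have hol: "k holomorphic_on cball 0 \<rho>"
    unfolding holomorphic_on_def field_differentiable_def
    using dk by (meson has_field_derivative_at_within mem_cball_0)
  have "(k has_field_derivative (1 / (2 * of_real pi * \<i>) * contour_integral (circlepath 0 \<rho>) (\<lambda>u. k u / (u - 0)^2))) (at 0)"
    by (rule Cauchy_derivative_integral_circlepath)
       (use hol \<rho> in \<open>auto intro: holomorphic_on_imp_continuous_on holomorphic_on_subset\<close>)
  hence "pd f v p = 1 / (2 * of_real pi * \<i>) * contour_integral (circlepath 0 \<rho>) (\<lambda>u. k u / u^2)"
    using DERIV_unique[OF dk[of 0]] \<rho> by simp
  also have "\<dots> = integral {0..1} (\<lambda>t. 1 / (2 * of_real pi * \<i>) * (k (circlepath 0 \<rho> t) / (circlepath 0 \<rho> t)^2 * vector_derivative (circlepath 0 \<rho>) (at t)))"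
    by (simp only: contour_integral_integral integral_mult_right)
  \<comment> \<open>On the circle du is 2 pi i u dt, which cancels the constant and one factor of
    the denominator.\<close>
  also have "\<dots> = integral {0..1} (\<lambda>t::real. k (\<rho> * exp (2 * of_real pi * \<i> * t)) * inverse (\<rho> * exp (2 * of_real pi * \<i> * t)))"
    by (intro integral_cong)
       (use \<rho> in \<open>simp only: vector_derivative_circlepath, simp only: circlepath, simp add: divide_simps power2_eq_square\<close>)
  finally show ?thesis by (simp add: k_def)
qed

text \<open>One curve \<open>\<gamma>\<close> serves all points near \<open>z\<close>. With a
  contour independent of the point, the integral can be differentiated with respect to the
  point.\<close>

lemma pd_local_integral:
  fixes f :: "complex ^ 'n \<Rightarrow> complex"
  assumes U: "open U" and f: "chol f U" and z: "z \<in> U"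
  obtains r :: real and \<gamma> :: "real \<Rightarrow> complex" where "r > 0" "ball z r \<subseteq> U" "continuous_on UNIV \<gamma>"
    "\<And>t. \<gamma> t \<noteq> 0" "\<And>p t. p \<in> ball z r \<Longrightarrow> p + \<gamma> t *s v \<in> U"
    "\<And>p. p \<in> ball z r \<Longrightarrow> pd f v p = integral {0..1} (\<lambda>t. f (p + \<gamma> t *s v) * inverse (\<gamma> t))"
proof -
  obtain e where e: "e > 0" "ball z e \<subseteq> U"
    using U z open_contains_ball by metis
  define r where "r = e / 2"
  have r: "r > 0" "ball z (2 * r) \<subseteq> U"
    using e by (auto simp: r_def)
  \<comment> \<open>This keeps the displacement \<open>c *s v\<close> below \<open>r\<close> in
    norm; the added 1 avoids division by zero for \<open>v = 0\<close>.\<close>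
  define \<rho> where "\<rho> = r / (norm v + 1)"
  have \<rho>: "\<rho> > 0"
    using r(1) norm_ge_zero[of v] unfolding \<rho>_def by (intro divide_pos_pos) linarith+
  define \<gamma> where "\<gamma> = (\<lambda>t::real. \<rho> * exp (2 * of_real pi * \<i> * t))"
  have sub: "p + c *s v \<in> U" if "p \<in> ball z r" "cmod c \<le> \<rho>" for p c
  proof -
    have "norm (c *s v) \<le> \<rho> * norm v"
      unfolding norm_vec_scale by (intro mult_right_mono that) auto
    also have "\<dots> \<le> \<rho> * (norm v + 1)"
      using \<rho> by simp
    also have "\<rho> * (norm v + 1) = r"
      using norm_ge_zero[of v] unfolding \<rho>_def by (intro nonzero_eq_divide_eq[THEN iffD1] refl) linarith
    finally have "p + c *s v \<in> ball z (2 * r)"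
      using that(1) norm_triangle_ineq[of "p - z" "c *s v"]
      by (simp add: dist_norm norm_minus_commute algebra_simps)
    thus ?thesis using r by auto
  qed
  show ?thesis
  proof
    show "r > 0" "ball z r \<subseteq> U" using r by auto
    show "continuous_on UNIV \<gamma>"
      unfolding \<gamma>_def by (intro continuous_intros)
    show "\<gamma> t \<noteq> 0" for t using \<rho> by (simp add: \<gamma>_def)
    show "p + \<gamma> t *s v \<in> U" if "p \<in> ball z r" for p t
      by (rule sub[OF that]) (use \<rho> in \<open>simp add: \<gamma>_def norm_mult\<close>)
    show "pd f v p = integral {0..1} (\<lambda>t. f (p + \<gamma> t *s v) * inverse (\<gamma> t))"
      if "p \<in> ball z r" for p
      unfolding \<gamma>_def by (rule pd_integral[OF f \<rho> sub[OF that]])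
  qed
qed

lemma continuous_on_kernel:
  fixes \<gamma> :: "real \<Rightarrow> complex" and v :: "complex ^ 'n" and g :: "complex ^ 'n \<Rightarrow> complex"
  assumes g: "continuous_on U g" and \<gamma>: "continuous_on UNIV \<gamma>" "\<And>t. \<gamma> t \<noteq> 0"
    and "\<And>p t. p \<in> B \<Longrightarrow> p + \<gamma> t *s v \<in> U"
  shows "continuous_on (B \<times> cbox 0 1) (\<lambda>(p, t). g (p + \<gamma> t *s v) * inverse (\<gamma> t))"
proof -
  have "continuous_on (B \<times> cbox 0 1) (\<lambda>(p, t). p + \<gamma> t *s v)"
    unfolding split_beta
    by (intro continuous_intros continuous_on_compose2[OF \<gamma>(1)]) auto
  thus ?thesis
    unfolding split_beta
    by (intro continuous_intros continuous_on_compose2[OF \<gamma>(1)] continuous_on_compose2[OF g])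
       (use assms in auto)
qed

text \<open>Comes before \<open>chol_pd\<close> because the Leibniz rule used there asks for a
  continuous derivative of the integrand, which is not part of \<open>chol\<close>.\<close>

lemma continuous_on_pd:
  assumes U: "open U" and f: "chol f U"
  shows "continuous_on U (pd f v)"
proof (rule continuous_at_imp_continuous_on, intro ballI)
  fix z assume z: "z \<in> U"
  obtain r and \<gamma> :: "real \<Rightarrow> complex" where r: "r > 0" and "ball z r \<subseteq> U" and \<gamma>: "continuous_on UNIV \<gamma>" "\<And>t. \<gamma> t \<noteq> 0"
    "\<And>p t. p \<in> ball z r \<Longrightarrow> p + \<gamma> t *s v \<in> U"
    and rep: "\<And>p. p \<in> ball z r \<Longrightarrow> pd f v p = integral {0..1} (\<lambda>t. f (p + \<gamma> t *s v) * inverse (\<gamma> t))"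
    by (rule pd_local_integral[OF U f z, of v]) (rule that, assumption+)
  have "continuous_on (ball z r) (\<lambda>p. integral (cbox 0 1) (\<lambda>t. f (p + \<gamma> t *s v) * inverse (\<gamma> t)))"
    by (intro integral_continuous_on_param continuous_on_kernel[OF chol_continuous_on[OF f] \<gamma>])
  hence "continuous_on (ball z r) (pd f v)"
    by (rule continuous_on_eq) (simp add: rep)
  thus "isCont (pd f v) z"
    using r by (simp add: continuous_on_eq_continuous_at)
qed

lemma chol_pd:
  fixes f :: "complex ^ 'n \<Rightarrow> complex"
  assumes U: "open U" and f: "chol f U"
  shows "chol (pd f v) U"
  unfolding chol_def has_cderiv_def
proof (intro ballI)
  fix z assume z: "z \<in> U"
  obtain r and \<gamma> :: "real \<Rightarrow> complex" where r: "r > 0" and "ball z r \<subseteq> U" and \<gamma>: "continuous_on UNIV \<gamma>" "\<And>t. \<gamma> t \<noteq> 0"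
    "\<And>p t. p \<in> ball z r \<Longrightarrow> p + \<gamma> t *s v \<in> U"
    and rep: "\<And>p. p \<in> ball z r \<Longrightarrow> pd f v p = integral {0..1} (\<lambda>t. f (p + \<gamma> t *s v) * inverse (\<gamma> t))"
    by (rule pd_local_integral[OF U f z, of v]) (rule that, assumption+)
  \<comment> \<open>The Leibniz rule takes the derivative as a bounded linear operator.
    \<open>Blinfun\<close> is meaningful only for bounded linear arguments, so \<open>K\<close> is
    evaluated only at points of the ball.\<close>
  define K where "K = (\<lambda>p t. Blinfun (\<lambda>u. pd f u (p + \<gamma> t *s v) * inverse (\<gamma> t)))"
  have line: "((\<lambda>p. f (p + \<gamma> t *s v) * inverse (\<gamma> t)) has_derivative
                 (\<lambda>u. pd f u (p + \<gamma> t *s v) * inverse (\<gamma> t))) (at p)"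
    if "p \<in> ball z r" for p t
  proof -
    have "((\<lambda>p. p + \<gamma> t *s v) has_derivative (\<lambda>u. u)) (at p)"
      by (auto intro!: derivative_eq_intros)
    from has_derivative_compose[OF this cholD(1)[OF f \<gamma>(3)[OF that]]]
    show ?thesis by (rule has_derivative_mult_left)
  qed
  have K: "blinfun_apply (K p t) = (\<lambda>u. pd f u (p + \<gamma> t *s v) * inverse (\<gamma> t))" if "p \<in> ball z r" for p t
    unfolding K_def by (rule bounded_linear_Blinfun_apply) (rule has_derivative_bounded_linear[OF line[OF that]])
  have contK: "continuous_on (ball z r \<times> cbox 0 1) (\<lambda>(p, t). K p t)"
    unfolding split_beta
  proof (rule continuous_on_blinfun_componentwise)
    fix u :: "complex ^ 'n"
    have "continuous_on (ball z r \<times> cbox 0 1) (\<lambda>(p, t). pd f u (p + \<gamma> t *s v) * inverse (\<gamma> t))"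
      by (rule continuous_on_kernel[OF continuous_on_pd[OF U f] \<gamma>])
    thus "continuous_on (ball z r \<times> cbox 0 1) (\<lambda>x. blinfun_apply (K (fst x) (snd x)) u)"
      by (rule continuous_on_eq) (auto simp: K)
  qed
  have "((\<lambda>p. integral (cbox 0 1) (\<lambda>t. f (p + \<gamma> t *s v) * inverse (\<gamma> t))) has_derivative
          integral (cbox 0 1) (K z)) (at z within ball z r)"
  proof (rule leibniz_rule[OF _ _ contK])
    show "((\<lambda>p. f (p + \<gamma> t *s v) * inverse (\<gamma> t)) has_derivative blinfun_apply (K p t)) (at p within ball z r)"
      if "p \<in> ball z r" for p t
      unfolding K[OF that] by (rule has_derivative_at_withinI[OF line[OF that]])
    show "(\<lambda>t. f (p + \<gamma> t *s v) * inverse (\<gamma> t)) integrable_on cbox 0 1" if "p \<in> ball z r" for p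
    proof -
      have "continuous_on (cbox 0 1) (\<lambda>t. case (p, t) of (p, t) \<Rightarrow> f (p + \<gamma> t *s v) * inverse (\<gamma> t))"
        by (rule continuous_on_compose2[OF continuous_on_kernel[where B = "ball z r", OF chol_continuous_on[OF f] \<gamma>(1,2)]])
           (use \<gamma>(3) that in \<open>auto intro!: continuous_intros\<close>)
      thus ?thesis by (intro integrable_continuous) simp
    qed
  qed (use r in auto)
  hence "((\<lambda>p. integral (cbox 0 1) (\<lambda>t. f (p + \<gamma> t *s v) * inverse (\<gamma> t))) has_derivative
          integral (cbox 0 1) (K z)) (at z)"
    using r by (subst (asm) at_within_open) auto
  hence "(pd f v has_derivative integral (cbox 0 1) (K z)) (at z)"
    by (rule has_derivative_transform_within_open[of _ _ _ _ "ball z r"]) (use r in \<open>auto simp: rep\<close>)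
  \<comment> \<open>Each \<open>K z t\<close> is complex-homogeneous, and integration over
    \<open>t\<close> preserves this.\<close>
  moreover have "blinfun_apply (integral (cbox 0 1) (K z)) (c *s u) = c * blinfun_apply (integral (cbox 0 1) (K z)) u" for c u
  proof -
    have zr: "z \<in> ball z r" using r by simp
    have "K z integrable_on cbox 0 1"
    proof -
      have "continuous_on (cbox 0 1) (\<lambda>t. case (z, t) of (p, t) \<Rightarrow> K p t)"
        by (rule continuous_on_compose2[OF contK]) (use zr in \<open>auto intro!: continuous_intros\<close>)
      thus ?thesis by (intro integrable_continuous) simp
    qed
    thus ?thesis
      by (simp only: blinfun_apply_integral K[OF zr] cholD(2)[OF f \<gamma>(3)[OF zr]] mult.assoc integral_mult_right)
  qed
  ultimately show "\<exists>D. (pd f v has_derivative D) (at z) \<and> (\<forall>c u. D (c *s u) = c * D u)"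
    by blast
qed

subsection \<open>Automorphisms of the ball and the Bergman metric\<close>

lemma bounded_bilinear_vec_scale: "bounded_bilinear (\<lambda>c (x :: complex ^ 'n). c *s x)"
  by (rule bounded_bilinear.intro)
     (auto simp: vec.scale_left_distrib vec.scale_right_distrib scaleR_eq_vec_scale scaleR_conv_of_real[where 'a = complex]
        mult_ac norm_vec_scale intro!: exI[of _ 1])

text \<open>
  The involution of the ball that exchanges \<open>0\<close> and \<open>p\<close>. The projection to the line of \<open>p\<close> is
  written with \<open>1 / (1 + s)\<close>, \<open>s = sqrt (1 - \<bar>p\<bar>\<^sup>2)\<close>, in place of \<open>(1 - s) / \<bar>p\<bar>\<^sup>2\<close>, so that \<open>p = 0\<close>
  is no special case.
\<close>

definition mob :: "complex ^ 'n \<Rightarrow> complex ^ 'n \<Rightarrow> complex ^ 'n" where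
  "mob p z = (1 / (1 - herm z p)) *s
     (p - of_real (sqrt (1 - (norm p)\<^sup>2)) *s z - (herm z p / of_real (1 + sqrt (1 - (norm p)\<^sup>2))) *s p)"

text \<open>The square of the length of \<open>v\<close> at \<open>p\<close> in the Bergman metric.\<close>

definition kap :: "complex ^ 'n \<Rightarrow> complex ^ 'n \<Rightarrow> real" where
  "kap p v = ((1 - (norm p)\<^sup>2) * (norm v)\<^sup>2 + (cmod (herm v p))\<^sup>2) / (1 - (norm p)\<^sup>2)\<^sup>2"

lemma one_minus_herm_nonzero:
  assumes "p \<in> ball 0 1" "z \<in> ball 0 1"
  shows "1 - herm z p \<noteq> 0"
proof -
  have "cmod (herm z p) \<le> norm z * norm p" by (rule cmod_herm_le)
  also have "\<dots> < 1" using assms mult_strict_mono'[of "norm z" 1 "norm p" 1] by simp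
  finally show ?thesis by auto
qed

context
  fixes p :: "complex ^ 'n" and s :: real
  assumes p: "p \<in> ball 0 1"
  defines "s \<equiv> sqrt (1 - (norm p)\<^sup>2)"
begin

lemma mob_s: "s > 0" "(norm p)\<^sup>2 = 1 - s\<^sup>2"
  "herm p p = 1 - (of_real s)\<^sup>2" "1 + complex_of_real s \<noteq> 0" "complex_of_real s \<noteq> 0"
proof -
  have "(norm p)\<^sup>2 < 1" using p by (simp add: power_less_one_iff)
  thus s: "s > 0" by (simp add: s_def)
  show n: "(norm p)\<^sup>2 = 1 - s\<^sup>2"
    using \<open>(norm p)\<^sup>2 < 1\<close> by (simp add: s_def)
  show "herm p p = 1 - (of_real s)\<^sup>2" by (simp add: herm_self n flip: of_real_power)
  show "complex_of_real s \<noteq> 0" using s by simp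
  show "1 + complex_of_real s \<noteq> 0" using s
    by (metis add_pos_pos less_irrefl of_real_1 of_real_add of_real_eq_0_iff zero_less_one)
qed

lemma mob_alt: "mob p z = (1 / (1 - herm z p)) *s (p - of_real s *s z - (herm z p / (1 + of_real s)) *s p)"
  by (simp add: mob_def s_def)

text \<open>The scalar that a second application of \<open>mob p\<close> needs besides the vector
  itself.\<close>

lemma herm_mob:
  assumes "z \<in> ball 0 1"
  shows "herm (mob p z) p = 1 - (of_real s)\<^sup>2 / (1 - herm z p)"
proof -
  define k where "k = herm z p"
  have k: "1 - k \<noteq> 0" using one_minus_herm_nonzero[OF p assms] by (simp add: k_def)
  have "herm (mob p z) p = 1 / (1 - k) * ((1 - (of_real s)\<^sup>2) - of_real s * k - k / (1 + of_real s) * (1 - (of_real s)\<^sup>2))"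
    by (simp add: mob_alt herm_simps mob_s k_def diff_divide_distrib)
  also have "\<dots> = 1 - (of_real s)\<^sup>2 / (1 - k)"
    using k mob_s(4) by (simp add: divide_simps) (simp add: algebra_simps power2_eq_square)
  finally show ?thesis by (simp add: k_def)
qed

lemma mob_mob:
  assumes z: "z \<in> ball 0 1"
  shows "mob p (mob p z) = z"
proof -
  define k where "k = herm z p"
  have k: "1 - k \<noteq> 0" using one_minus_herm_nonzero[OF p z] by (simp add: k_def)
  \<comment> \<open>The cancellation in one coordinate: \<open>a\<close> and \<open>b\<close> stand
    for the components of \<open>p\<close> and \<open>z\<close>, and \<open>c\<close> for
    \<open>s\<close>.\<close>
  have aux: "a - c * (1 / (1 - k) * (a - c * b - k / (1 + c) * a)) - (1 - c\<^sup>2 / (1 - k)) / (1 + c) * a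
               = c\<^sup>2 / (1 - k) * b" if "1 + c \<noteq> 0" for a b c
    using k that by (simp add: divide_simps) (simp add: algebra_simps power2_eq_square)
  have "mob p (mob p z) = (1 / ((of_real s)\<^sup>2 / (1 - k))) *s
     (p - of_real s *s mob p z - ((1 - (of_real s)\<^sup>2 / (1 - k)) / (1 + of_real s)) *s p)"
    unfolding mob_alt[of "mob p z"] herm_mob[OF z] by (simp add: k_def)
  also have "p - of_real s *s mob p z - ((1 - (of_real s)\<^sup>2 / (1 - k)) / (1 + of_real s)) *s p
     = ((of_real s)\<^sup>2 / (1 - k)) *s z"
    using aux[OF mob_s(4)] unfolding mob_alt[of z] k_def[symmetric] vec_eq_iff
    by (simp only: vector_minus_component vector_smult_component simp_thms)
  also have "(1 / ((of_real s)\<^sup>2 / (1 - k))) *s \<dots> = z"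
    using k mob_s(5) by simp
  finally show ?thesis .
qed

text \<open>The right-hand side is positive, which shows that the ball is preserved.\<close>

lemma norm_mob:
  assumes z: "z \<in> ball 0 1"
  shows "1 - (norm (mob p z))\<^sup>2 = s\<^sup>2 * (1 - (norm z)\<^sup>2) / (cmod (1 - herm z p))\<^sup>2"
proof -
  define k where "k = herm z p"
  have k: "1 - k \<noteq> 0" "1 - cnj k \<noteq> 0"
    using one_minus_herm_nonzero[OF p z] by (auto simp: k_def)
  have k': "herm p z = cnj k" unfolding k_def by (simp only: cnj_herm)
  have zz: "of_real ((norm z)\<^sup>2) = herm z z" by (simp only: herm_self)
  have "complex_of_real (1 - (norm (mob p z))\<^sup>2) = 1 - herm (mob p z) (mob p z)"
    by (simp add: herm_self)
  also have "\<dots> = (of_real s)\<^sup>2 * (1 - herm z z) / ((1 - k) * (1 - cnj k))"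
    unfolding mob_alt herm_simps k_def[symmetric] k' mob_s(3)
    using k mob_s(4) by (simp add: divide_simps) (simp add: algebra_simps power2_eq_square)
  also have "\<dots> = of_real (s\<^sup>2 * (1 - (norm z)\<^sup>2) / (cmod (1 - k))\<^sup>2)"
    using complex_norm_square[of "1 - k"] by (simp add: herm_self)
  finally show ?thesis unfolding k_def of_real_eq_iff .
qed

lemma mob_in_ball:
  assumes z: "z \<in> ball 0 1"
  shows "mob p z \<in> ball 0 1"
proof -
  have "(norm z)\<^sup>2 < 1" using z by (simp add: power_less_one_iff)
  hence "0 < s\<^sup>2 * (1 - (norm z)\<^sup>2) / (cmod (1 - herm z p))\<^sup>2"
    using one_minus_herm_nonzero[OF p z] mob_s(1) by simp
  hence "(norm (mob p z))\<^sup>2 < 1" using norm_mob[OF z] by linarith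
  thus ?thesis by (simp add: power_less_one_iff)
qed

lemma mob_zero: "mob p 0 = p"
  by (simp add: mob_alt herm_simps)

text \<open>Besides giving \<open>mob_self\<close>, this removes the derivative of the scalar factor
  when \<open>mob p\<close> is differentiated at \<open>p\<close>.\<close>

lemma mob_numerator: "p - of_real s *s p - (herm p p / (1 + of_real s)) *s p = 0"
proof -
  have "1 - of_real s - (1 - (of_real s)\<^sup>2) / (1 + of_real s) = (0 :: complex)"
    using mob_s(4) by (simp add: divide_simps) (simp add: algebra_simps power2_eq_square)
  hence "(1 - of_real s - (1 - (of_real s)\<^sup>2) / (1 + of_real s)) *s p = 0" by simp
  thus ?thesis
    by (simp only: vec.scale_left_diff_distrib vec.scale_one mob_s(3))
qed

lemma mob_self: "mob p p = 0"
  by (simp add: mob_alt mob_numerator)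

lemma holomorphic_mob: "holomorphic_map_on (mob p) (ball 0 1)"
  unfolding holomorphic_map_on_def
proof (intro ballI exI conjI)
  fix z assume z: "z \<in> ball (0 :: complex ^ 'n) 1"
  define D1 where "D1 = (\<lambda>v. herm v p / (1 - herm z p)\<^sup>2)"
  define N where "N = (\<lambda>z. p - of_real s *s z - (herm z p / (1 + of_real s)) *s p)"
  define D2 where "D2 = (\<lambda>v. - (of_real s *s v) - (herm v p / (1 + of_real s)) *s p)"
  have dN: "(N has_derivative D2) (at z)"
    unfolding N_def D2_def divide_inverse
    by (rule derivative_eq_intros refl)+ (simp add: fun_eq_iff)
  have "((\<lambda>z. 1 / (1 - herm z p)) has_derivative D1) (at z)"
    using one_minus_herm_nonzero[OF p z]
    by (auto intro!: derivative_eq_intros simp: D1_def fun_eq_iff power2_eq_square)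
  from bounded_bilinear.FDERIV[OF bounded_bilinear_vec_scale this dN]
  show "(mob p has_derivative (\<lambda>v. (1 / (1 - herm z p)) *s D2 v + D1 v *s N z)) (at z)"
    unfolding mob_alt[abs_def] N_def .
  show "Vector_Spaces.linear (*s) (*s) (\<lambda>v. (1 / (1 - herm z p)) *s D2 v + D1 v *s N z)"
    by unfold_locales
       (simp_all add: D1_def D2_def vec_eq_iff herm_simps add_divide_distrib algebra_simps)
qed

text \<open>Since \<open>mob p\<close> moves \<open>p\<close> to \<open>0\<close>, this exhibits
  \<open>kap p\<close> as the pullback of the Euclidean metric at the centre.\<close>

lemma norm_deriv_mob:
  obtains D where "(mob p has_derivative D) (at p)" "\<And>c v. D (c *s v) = c *s D v"
    "\<And>v. (norm (D v))\<^sup>2 = kap p v"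
proof
  define D where "D = (\<lambda>v. (1 / (of_real s)\<^sup>2) *s (- (of_real s *s v) - (herm v p / (1 + of_real s)) *s p))"
  define N where "N = (\<lambda>z. p - of_real s *s z - (herm z p / (1 + of_real s)) *s p)"
  have N: "N p = 0"
    using mob_numerator by (simp add: N_def)
  have dN: "(N has_derivative (\<lambda>v. - (of_real s *s v) - (herm v p / (1 + of_real s)) *s p)) (at p)"
    unfolding N_def divide_inverse
    by (rule derivative_eq_intros refl)+ (simp add: fun_eq_iff)
  have "((\<lambda>z. 1 / (1 - herm z p)) has_derivative (\<lambda>v. herm v p / (1 - herm p p)\<^sup>2)) (at p)"
    using one_minus_herm_nonzero[OF p p]
    by (auto intro!: derivative_eq_intros simp: fun_eq_iff power2_eq_square)
  from bounded_bilinear.FDERIV[OF bounded_bilinear_vec_scale this dN]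
  have "((\<lambda>z. (1 / (1 - herm z p)) *s N z) has_derivative D) (at p)"
    by (simp add: N D_def mob_s(3))
  thus "(mob p has_derivative D) (at p)"
    unfolding mob_alt[abs_def] N_def .
  show "D (c *s v) = c *s D v" for c v
    by (simp add: D_def vec_eq_iff herm_simps algebra_simps)
  show "(norm (D v))\<^sup>2 = kap p v" for v
  proof -
    have "complex_of_real ((norm (D v))\<^sup>2) = herm (D v) (D v)" by (simp only: herm_self)
    also have "\<dots> = ((of_real s)\<^sup>2 * herm v v + herm v p * herm p v) / (of_real s) ^ 4"
      unfolding D_def herm_simps mob_s(3) cnj_herm
      using mob_s(4,5) by (simp add: cnj_herm divide_simps) (simp add: algebra_simps eval_nat_numeral)
    also have "herm v p * herm p v = (of_real (cmod (herm v p)))\<^sup>2"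
      using complex_norm_square[of "herm v p"] by (simp add: cnj_herm)
    finally have "complex_of_real ((norm (D v))\<^sup>2) = of_real ((s\<^sup>2 * (norm v)\<^sup>2 + (cmod (herm v p))\<^sup>2) / s ^ 4)"
      by (simp add: herm_self)
    hence "(norm (D v))\<^sup>2 = (s\<^sup>2 * (norm v)\<^sup>2 + (cmod (herm v p))\<^sup>2) / s ^ 4"
      unfolding of_real_eq_iff .
    also have "\<dots> = kap p v" by (simp add: kap_def mob_s(2))
    finally show ?thesis .
  qed
qed

end

subsection \<open>A Schwarz--Pick inequality across the zero set of a continuous function\<close>

text \<open>
  As in the proof of Rado's theorem, holomorphy may fail on the zeros of \<open>h\<close>: the factor \<open>h\<close> makes
  the maximum principle applicable to \<open>(u z / z) ^ N * h z\<close>, and \<open>N \<rightarrow> \<infinity>\<close> removes its effect.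
\<close>

lemma schwarz_derivative_rado:
  fixes u h :: "complex \<Rightarrow> complex"
  assumes cu: "continuous_on (ball 0 1) u" and ch: "continuous_on (ball 0 1) h"
    and du: "\<And>z. z \<in> ball 0 1 \<Longrightarrow> h z \<noteq> 0 \<Longrightarrow> u field_differentiable at z"
    and dh: "\<And>z. z \<in> ball 0 1 \<Longrightarrow> h z \<noteq> 0 \<Longrightarrow> h field_differentiable at z"
    and u1: "\<And>z. z \<in> ball 0 1 \<Longrightarrow> cmod (u z) \<le> 1" and u0: "u 0 = 0" and h0: "h 0 \<noteq> 0"
    and d: "(u has_field_derivative d) (at 0)"
  shows "cmod d \<le> 1"
proof -
  define Q where "Q = {z \<in> ball 0 1. h z \<noteq> 0}"
  have "Q = ball 0 1 \<inter> h -` (- {0})" by (auto simp: Q_def)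
  hence oQ: "open Q"
    using continuous_open_preimage[OF ch open_ball, of "- {0}"] by (simp add: open_Compl)
  have Q0: "0 \<in> Q" using h0 by (simp add: Q_def)
  have hu: "u holomorphic_on Q" and hh: "h holomorphic_on Q"
    using du dh by (auto simp: holomorphic_on_def Q_def intro: field_differentiable_at_within)
  \<comment> \<open>The quotient \<open>u z / z\<close> with its removable singularity filled in;
    its value at \<open>0\<close> is \<open>d\<close>.\<close>
  define v where "v = (\<lambda>z. if z = 0 then deriv u 0 else (u z - u 0) / (z - 0))"
  have hv: "v holomorphic_on Q"
    unfolding v_def using pole_lemma[OF hu, of 0] oQ Q0 by (simp add: interior_open)
  have v0: "v 0 = d" using DERIV_imp_deriv[OF d] by (simp add: v_def)
  have cv: "continuous_on (ball 0 1) v"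
  proof -
    \<comment> \<open>Continuity of \<open>u\<close> settles the punctured disc, and holomorphy on
      \<open>Q\<close> settles a neighbourhood of \<open>0\<close>; both sets are open.\<close>
    have "continuous_on (ball 0 1 - {0}) (\<lambda>z. (u z - u 0) / (z - 0))"
      by (intro continuous_intros continuous_on_subset[OF cu]) auto
    hence "continuous_on (ball 0 1 - {0}) v"
      by (rule continuous_on_eq) (auto simp: v_def)
    moreover have "continuous_on Q v"
      using hv by (rule holomorphic_on_imp_continuous_on)
    moreover have "(ball 0 1 - {0}) \<union> Q = ball 0 1"
      using Q0 by (auto simp: Q_def)
    ultimately show ?thesis
      using continuous_on_open_Un[OF _ oQ, of "ball 0 1 - {0}" v] by (simp add: open_delete)
  qed
  have bound: "r * cmod d \<le> 1" if r: "0 < r" "r < 1" for r :: real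
  proof (rule ccontr)
    assume "\<not> r * cmod d \<le> 1"
    hence gt: "r * cmod d > 1" by simp
    have sub: "cball 0 r \<subseteq> ball (0 :: complex) 1" using r by auto
    have "compact (h ` cball 0 r)"
      by (rule compact_continuous_image[OF continuous_on_subset[OF ch sub] compact_cball])
    then obtain M where M: "\<And>z. z \<in> cball 0 r \<Longrightarrow> cmod (h z) \<le> M"
      by (metis compact_imp_bounded bounded_iff imageI)
    define S where "S = Q \<inter> ball 0 r"
    have oS: "open S" using oQ by (simp add: S_def open_Int)
    have clS: "closure S \<subseteq> cball 0 r"
      by (metis S_def closure_minimal closed_cball inf_le2 ball_subset_cball order_trans)
    have "(r * cmod d) ^ N \<le> M / cmod (h 0)" for N
    proof -
      define \<Phi> where "\<Phi> = (\<lambda>z. v z ^ N * h z)"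
      \<comment> \<open>On the frontier of \<open>S\<close> either \<open>h\<close> and with it
        \<open>\<Phi>\<close> vanishes, or \<open>cmod z = r\<close> and \<open>v\<close> is at most
        \<open>1 / r\<close> in modulus.\<close>
      have "cmod (\<Phi> 0) \<le> (1 / r) ^ N * M"
      proof (rule maximum_modulus_frontier[where f = \<Phi> and S = S and \<xi> = 0])
        show "\<Phi> holomorphic_on interior S"
          unfolding \<Phi>_def interior_open[OF oS]
          by (intro holomorphic_intros holomorphic_on_subset[OF hv] holomorphic_on_subset[OF hh])
             (auto simp: S_def)
        show "continuous_on (closure S) \<Phi>"
          unfolding \<Phi>_def using clS sub
          by (intro continuous_intros continuous_on_subset[OF cv] continuous_on_subset[OF ch]) auto
        show "bounded S" by (metis S_def bounded_Int bounded_ball)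
        show "0 \<in> S" using Q0 r by (simp add: S_def)
        fix z assume "z \<in> frontier S"
        hence z: "z \<in> closure S" "z \<notin> S" using interior_open[OF oS] by (auto simp: frontier_def)
        have zr: "z \<in> cball 0 r" using z clS by auto
        have M0: "0 \<le> M" using M[OF zr] norm_ge_zero order_trans by blast
        show "cmod (\<Phi> z) \<le> (1 / r) ^ N * M"
        proof (cases "h z = 0")
          case True
          thus ?thesis using M0 r by (simp add: \<Phi>_def)
        next
          case False
          hence "cmod z = r"
            using z zr sub by (force simp: S_def Q_def)
          hence "cmod (v z) \<le> 1 / r"
            using r u1[of z] zr sub by (auto simp: v_def u0 norm_divide divide_right_mono)
          thus ?thesis
            unfolding \<Phi>_def norm_mult norm_power
            using M[OF zr] r by (intro mult_mono power_mono) auto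
        qed
      qed
      thus ?thesis
        using r h0 by (simp add: \<Phi>_def v0 norm_mult norm_power field_simps)
    qed
    moreover obtain N where "M / cmod (h 0) < (r * cmod d) ^ N"
      using real_arch_pow[OF gt] by blast
    ultimately show False by (meson not_le)
  qed
  show ?thesis
  proof (rule ccontr)
    assume "\<not> ?thesis"
    hence d1: "cmod d > 1" by simp
    hence "1 / cmod d < 1" by (simp add: divide_simps)
    then obtain r where "1 / cmod d < r" "r < 1" using dense by blast
    moreover from this have "r > 0" using d1 by (meson divide_pos_pos less_trans zero_less_one)
    moreover have "d \<noteq> 0" using d1 by auto
    ultimately show False using bound[of r] d1 pos_divide_less_eq[of "cmod d" 1 r] by simp
  qed
qed

section \<open>The Schwarz--Pick inequality in several variables\<close>

lemma vec_linear_simps: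
  fixes D :: "complex ^ 'k \<Rightarrow> complex ^ 'l"
  assumes "Vector_Spaces.linear (*s) (*s) D"
  shows "D (x + y) = D x + D y" "D (x - y) = D x - D y" "D (c *s x) = c *s D x" "D 0 = 0" "D (- x) = - D x"
proof -
  interpret Vector_Spaces.linear "(*s)" "(*s)" D by fact
  show "D (x + y) = D x + D y" "D (x - y) = D x - D y" "D (c *s x) = c *s D x" "D 0 = 0" "D (- x) = - D x"
    by (simp_all add: add diff scale zero neg)
qed

lemma continuous_on_mob:
  fixes p :: "complex ^ 'n"
  assumes "p \<in> ball 0 1" shows "continuous_on (ball 0 1) (mob p)"
proof (rule continuous_at_imp_continuous_on, intro ballI)
  fix z :: "complex ^ 'n" assume "z \<in> ball 0 1"
  then obtain D where "(mob p has_derivative D) (at z)"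
    using holomorphic_mob[OF assms] unfolding holomorphic_map_on_def by blast
  thus "isCont (mob p) z" by (rule has_derivative_continuous)
qed

lemma kap_nonneg: "p \<in> ball 0 1 \<Longrightarrow> 0 \<le> kap p v"
  by (auto simp: kap_def power_le_one_iff abs_square_le_1 intro!: divide_nonneg_nonneg add_nonneg_nonneg mult_nonneg_nonneg)

text \<open>Rests on \<open>t \<le> 1\<close>. It makes \<open>kap p\<close> nondegenerate.\<close>

lemma kap_ge:
  assumes "p \<in> ball 0 1" shows "(norm v)\<^sup>2 \<le> kap p v"
proof -
  define t where "t = 1 - (norm p)\<^sup>2"
  have t: "0 < t" "t \<le> 1" using assms by (auto simp: t_def power_less_one_iff)
  have "(norm v)\<^sup>2 * t\<^sup>2 \<le> (norm v)\<^sup>2 * t"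
    using t by (intro mult_left_mono) (auto simp: power2_eq_square mult_le_cancel_left1)
  hence "(norm v)\<^sup>2 * t\<^sup>2 \<le> t * (norm v)\<^sup>2 + (cmod (herm v p))\<^sup>2"
    by (metis add_increasing2 mult.commute zero_le_power2)
  thus ?thesis
    using t by (simp add: kap_def t_def[symmetric] pos_le_divide_eq)
qed

text \<open>Together with \<open>kap_ge\<close> it turns inequalities between Bergman lengths into
  Euclidean ones in \<open>J_nonzero\<close>.\<close>

lemma kap_le:
  assumes "p \<in> ball 0 1" shows "kap p v \<le> (norm v)\<^sup>2 / (1 - (norm p)\<^sup>2)\<^sup>2"
proof -
  have "(cmod (herm v p))\<^sup>2 \<le> (norm v * norm p)\<^sup>2"
    by (intro power_mono cmod_herm_le norm_ge_zero)
  hence "(1 - (norm p)\<^sup>2) * (norm v)\<^sup>2 + (cmod (herm v p))\<^sup>2 \<le> (norm v)\<^sup>2"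
    by (simp add: algebra_simps power_mult_distrib)
  thus ?thesis unfolding kap_def by (intro divide_right_mono) auto
qed

lemma kap_scale: "kap p (c *s v) = (cmod c)\<^sup>2 * kap p v"
  by (simp add: kap_def herm_simps norm_mult norm_vec_scale power_mult_distrib algebra_simps add_divide_distrib)

text \<open>Composing with \<open>mob P\<close> and \<open>mob (H P)\<close> moves both points to
  \<open>0\<close>. There one complex line in the source and one component in the target suffice,
  and \<open>schwarz_derivative_rado\<close> applies.\<close>

lemma schwarz_pick_rado:
  fixes H :: "complex ^ 'k \<Rightarrow> complex ^ 'l" and h :: "complex ^ 'k \<Rightarrow> complex"
  assumes P: "P \<in> ball 0 1" and cH: "continuous_on (ball 0 1) H" and ch: "continuous_on (ball 0 1) h"
    and Hb: "\<And>z. z \<in> ball 0 1 \<Longrightarrow> H z \<in> ball 0 1"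
    and dH: "\<And>z. z \<in> ball 0 1 \<Longrightarrow> h z \<noteq> 0 \<Longrightarrow>
                \<exists>D. (H has_derivative D) (at z) \<and> Vector_Spaces.linear (*s) (*s) D"
    and dh: "\<And>z. z \<in> ball 0 1 \<Longrightarrow> h z \<noteq> 0 \<Longrightarrow> \<exists>D. has_cderiv h D z"
    and hP: "h P \<noteq> 0"
    and D: "(H has_derivative D) (at P)" "Vector_Spaces.linear (*s) (*s) D"
  shows "kap (H P) (D v) \<le> kap P v"
proof -
  have HP: "H P \<in> ball 0 1" by (rule Hb[OF P])
  obtain E where E: "(mob P has_derivative E) (at P)" "\<And>c v. E (c *s v) = c *s E v"
      "\<And>v. (norm (E v))\<^sup>2 = kap P v"
    using norm_deriv_mob[OF P] by metis
  obtain E' where E': "(mob (H P) has_derivative E') (at (H P))" "\<And>c v. E' (c *s v) = c *s E' v"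
      "\<And>v. (norm (E' v))\<^sup>2 = kap (H P) v"
    using norm_deriv_mob[OF HP] by metis
  obtain E0 where E0: "(mob P has_derivative E0) (at 0)" "Vector_Spaces.linear (*s) (*s) E0"
    using holomorphic_mob[OF P] by (force simp: holomorphic_map_on_def)
  have linE: "linear E" by (rule has_derivative_linear[OF E(1)])
  have E_inj: "x = 0" if "E x = 0" for x
    using E(3)[of x] kap_ge[OF P, of x] that by simp
  have EE0: "E (E0 y) = y" for y
  proof -
    have "((\<lambda>z. mob P (mob P z)) has_derivative (\<lambda>y. E (E0 y))) (at 0)"
      using has_derivative_compose[OF E0(1)] E(1) mob_zero[OF P] by metis
    moreover have "((\<lambda>z. z) has_derivative (\<lambda>y. y)) (at (0 :: complex ^ 'k))" by simp
    hence "((\<lambda>z. mob P (mob P z)) has_derivative (\<lambda>y. y)) (at 0)"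
      by (rule has_derivative_transform_within_open[of _ _ _ _ "ball 0 1"]) (use mob_mob[OF P] in auto)
    ultimately show ?thesis by (metis has_derivative_unique)
  qed
  \<comment> \<open>\<open>mob P\<close> is an involution, so its derivatives at \<open>0\<close>
    and at \<open>P\<close> are mutually inverse. Hence the disc \<open>l\<close> below has velocity
    \<open>v\<close> at \<open>0\<close>.\<close>
  have E0E: "E0 (E v) = v" for v
    using E_inj[of "E0 (E v) - v"] EE0[of "E v"] linear_diff[OF linE] by simp
  have main: "norm (E' (D v)) \<le> 1" if v: "norm (E v) = 1" for v
  proof (cases "E' (D v) = 0")
    case False
    \<comment> \<open>The component of \<open>E' (D v)\<close> along this unit vector is its full
      norm.\<close>
    define \<xi> where "\<xi> = (1 / norm (E' (D v))) *\<^sub>R E' (D v)"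
    have n\<xi>: "norm \<xi> = 1" using False by (simp add: \<xi>_def)
    define l where "l = (\<lambda>t. mob P (t *s E v))"
    have tE: "t *s E v \<in> ball 0 1" if "t \<in> ball 0 1" for t
      using that v by (simp add: norm_vec_scale)
    have lb: "l t \<in> ball 0 1" if "t \<in> ball 0 1" for t
      unfolding l_def by (rule mob_in_ball[OF P tE[OF that]])
    have cl: "continuous_on (ball 0 1) l"
      unfolding l_def
      by (rule continuous_on_compose2[OF continuous_on_mob[OF P]]) (use tE in \<open>auto intro!: continuous_intros\<close>)
    have dl: "\<exists>w. (l has_derivative (\<lambda>c. c *s w)) (at t)" if t: "t \<in> ball 0 1" for t
    proof -
      obtain A where A: "(mob P has_derivative A) (at (t *s E v))" "Vector_Spaces.linear (*s) (*s) A"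
        using holomorphic_mob[OF P] tE[OF t] by (force simp: holomorphic_map_on_def)
      have "((\<lambda>t. t *s E v) has_derivative (\<lambda>c. c *s E v)) (at t)"
        by (auto intro!: derivative_eq_intros)
      from has_derivative_compose[OF this A(1)]
      show ?thesis unfolding l_def vec_linear_simps(3)[OF A(2)] by blast
    qed
    have l0: "l 0 = P" by (simp add: l_def mob_zero[OF P])
    define u where "u = (\<lambda>t. herm (mob (H P) (H (l t))) \<xi>)"
    have "cmod (herm (E' (D v)) \<xi>) \<le> 1"
    proof (rule schwarz_derivative_rado[where u = u and h = "\<lambda>t. h (l t)"])
      show "continuous_on (ball 0 1) (\<lambda>t. h (l t))"
        by (rule continuous_on_compose2[OF ch cl]) (use lb in auto)
      have "continuous_on (ball 0 1) (\<lambda>t. H (l t))"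
        by (rule continuous_on_compose2[OF cH cl]) (use lb in auto)
      hence "continuous_on (ball 0 1) (\<lambda>t. mob (H P) (H (l t)))"
        by (rule continuous_on_compose2[OF continuous_on_mob[OF HP]]) (use lb Hb in blast)
      thus "continuous_on (ball 0 1) u"
        unfolding u_def by (intro continuous_intros)
      show "h (l 0) \<noteq> 0" using hP l0 by simp
      show "u 0 = 0" by (simp add: u_def l0 mob_self[OF HP] herm_simps)
      show "cmod (u t) \<le> 1" if "t \<in> ball 0 1" for t
      proof -
        have "norm (mob (H P) (H (l t))) < 1"
          using mob_in_ball[OF HP Hb[OF lb[OF that]]] by simp
        thus ?thesis
          using cmod_herm_le[of "mob (H P) (H (l t))" \<xi>] n\<xi> by (simp add: u_def)
      qed
      \<comment> \<open>Chain rule at an arbitrary parameter: it yields differentiability off the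
        zeros of \<open>h\<close> and the value of the derivative at \<open>0\<close>.\<close>
      have du: "(u has_field_derivative herm (B (A w)) \<xi>) (at t)"
        if "(l has_derivative (\<lambda>c. c *s w)) (at t)" "(H has_derivative A) (at (l t))"
          "\<And>c v. A (c *s v) = c *s A v" "(mob (H P) has_derivative B) (at (H (l t)))"
          "\<And>c v. B (c *s v) = c *s B v" for t w A B
      proof -
        have "(u has_derivative (\<lambda>c. herm (B (A (c *s w))) \<xi>)) (at t)"
          unfolding u_def
          by (rule has_derivative_herm[OF has_derivative_compose[OF has_derivative_compose[OF that(1,2)] that(4)]])
        moreover have "(\<lambda>c. herm (B (A (c *s w))) \<xi>) = (*) (herm (B (A w)) \<xi>)"
          by (simp add: fun_eq_iff that herm_simps)
        ultimately show ?thesis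
          by (simp add: has_field_derivative_def)
      qed
      show "u field_differentiable at t" if t: "t \<in> ball 0 1" and ht: "h (l t) \<noteq> 0" for t
      proof -
        obtain w where w: "(l has_derivative (\<lambda>c. c *s w)) (at t)" using dl[OF t] by blast
        obtain A where A: "(H has_derivative A) (at (l t))" "Vector_Spaces.linear (*s) (*s) A"
          using dH[OF lb[OF t] ht] by blast
        obtain B where B: "(mob (H P) has_derivative B) (at (H (l t)))" "Vector_Spaces.linear (*s) (*s) B"
          using holomorphic_mob[OF HP] Hb[OF lb[OF t]] by (force simp: holomorphic_map_on_def)
        show ?thesis
          using du[OF w A(1) vec_linear_simps(3)[OF A(2)] B(1) vec_linear_simps(3)[OF B(2)]]
          by (auto simp: field_differentiable_def)
      qed
      show "(\<lambda>t. h (l t)) field_differentiable at t" if t: "t \<in> ball 0 1" and ht: "h (l t) \<noteq> 0" for t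
      proof -
        obtain w where w: "(l has_derivative (\<lambda>c. c *s w)) (at t)" using dl[OF t] by blast
        have "chol h {l t}" using dh[OF lb[OF t] ht] by (auto simp: chol_def)
        from chol_has_field_derivative[OF this _ w] show ?thesis
          by (auto simp: field_differentiable_def)
      qed
      have 1: "((\<lambda>t. t *s E v) has_derivative (\<lambda>c. c *s E v)) (at 0)"
        by (auto intro!: derivative_eq_intros)
      have 2: "(mob P has_derivative E0) (at (0 *s E v))" using E0(1) by simp
      have "(l has_derivative (\<lambda>c. c *s v)) (at 0)"
        using has_derivative_compose[OF 1 2]
        by (simp add: l_def[abs_def] vec_linear_simps(3)[OF E0(2)] E0E)
      from du[OF this, of D E'] show "(u has_field_derivative herm (E' (D v)) \<xi>) (at 0)"
        using D(1) E'(1,2) vec_linear_simps(3)[OF D(2)] by (simp add: l0)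
    qed
    also have "herm (E' (D v)) \<xi> = of_real (norm (E' (D v)))"
      using False by (simp add: \<xi>_def scaleR_eq_vec_scale herm_simps herm_self power2_eq_square)
    finally show ?thesis by simp
  qed simp
  show ?thesis
  proof (cases "v = 0")
    case True
    thus ?thesis using vec_linear_simps(4)[OF D(2)] by (simp add: kap_def herm_simps)
  next
    case False
    \<comment> \<open>\<open>c\<close> is the Bergman length of \<open>v\<close> at
      \<open>P\<close>, and by homogeneity \<open>v\<close> may be scaled to length 1.\<close>
    define c where "c = norm (E v)"
    have c: "c > 0" using E_inj[of v] False by (auto simp: c_def)
    have "norm (E ((of_real (1 / c)) *s v)) = 1"
      using c by (simp add: E(2) norm_vec_scale c_def norm_divide)
    from main[OF this] have "norm (E' (D v)) \<le> c"
      using c by (simp add: vec_linear_simps(3)[OF D(2)] E'(2) norm_vec_scale norm_divide)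
    hence "(norm (E' (D v)))\<^sup>2 \<le> (norm (E v))\<^sup>2"
      unfolding c_def by (intro power_mono) auto
    thus ?thesis by (simp add: E(3) E'(3))
  qed
qed

subsection \<open>Holomorphic bijections from a slice of the ball\<close>

text \<open>\<open>baby_Sard\<close> is applied in real coordinates: \<open>'m bit0\<close> has
  twice as many elements as \<open>'m\<close>, so \<open>real ^ 'm bit0\<close> has the real
  dimension of \<open>complex ^ 'm\<close>.\<close>

lemma sard_complex:
  fixes f :: "complex ^ 'm \<Rightarrow> complex ^ 'm"
  assumes der: "\<And>x. x \<in> U \<Longrightarrow> (f has_derivative f' x) (at x)"
    and sing: "\<And>x. x \<in> U \<Longrightarrow> \<not> inj (f' x)"
  shows "negligible (f ` U)"
proof -
  have "DIM(complex ^ 'm) = DIM(real ^ 'm bit0)" by simp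
  then obtain \<phi> :: "complex ^ 'm \<Rightarrow> real ^ 'm bit0" and \<psi> where
    lin: "linear \<phi>" "linear \<psi>" and inv: "\<And>x. \<psi> (\<phi> x) = x" "\<And>y. \<phi> (\<psi> y) = y"
    by (rule isomorphisms_UNIV_UNIV) (rule that, assumption+)
  have bl: "bounded_linear \<phi>" "bounded_linear \<psi>" using lin by (simp_all add: linear_conv_bounded_linear)
  define g where "g = (\<lambda>y. \<phi> (f (\<psi> y)))"
  define g' where "g' = (\<lambda>y v. \<phi> (f' (\<psi> y) (\<psi> v)))"
  have "negligible (g ` (\<phi> ` U))"
  proof (rule baby_Sard)
    fix y assume "y \<in> \<phi> ` U"
    hence y: "\<psi> y \<in> U" using inv by auto
    show dg: "(g has_derivative g' y) (at y within \<phi> ` U)"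
      unfolding g_def g'_def
      by (rule has_derivative_at_withinI)
         (rule bounded_linear.has_derivative[OF bl(1) has_derivative_compose[OF bounded_linear_imp_has_derivative[OF bl(2)] der[OF y]]])
    have "(*v) (matrix (g' y)) = g' y"
      using matrix_works[of "g' y"] has_derivative_linear[OF dg]
      by (auto simp: fun_eq_iff linear_linear)
    moreover have "\<not> inj (g' y)"
    proof
      assume "inj (g' y)"
      hence "inj (f' (\<psi> y))"
        unfolding inj_def g'_def by (metis inv)
      thus False using sing[OF y] by simp
    qed
    ultimately show "rank (matrix (g' y)) < CARD('m bit0)"
      by (simp only: less_rank_noninjective not_False_eq_True)
  qed simp
  hence "negligible (\<psi> ` (g ` (\<phi> ` U)))"
    by (rule negligible_differentiable_image_negligible[rotated])
       (use lin in \<open>auto simp: linear_imp_differentiable_on\<close>)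
  also have "\<psi> ` (g ` (\<phi> ` U)) = f ` U"
    by (simp add: image_image g_def inv)
  finally show ?thesis .
qed

section \<open>Derivatives and Jacobians of holomorphic maps\<close>

definition vd :: "(complex ^ 'n \<Rightarrow> complex ^ 'm) \<Rightarrow> complex ^ 'n \<Rightarrow> complex ^ 'n \<Rightarrow> complex ^ 'm" where
  "vd F p = frechet_derivative F (at p)"

lemma vdD:
  assumes "holomorphic_map_on F U" "p \<in> U"
  shows "(F has_derivative vd F p) (at p)" "Vector_Spaces.linear (*s) (*s) (vd F p)"
proof -
  obtain D where D: "(F has_derivative D) (at p)" "Vector_Spaces.linear (*s) (*s) D"
    using assms unfolding holomorphic_map_on_def by blast
  have "D = vd F p" unfolding vd_def by (rule frechet_derivative_at[OF D(1)])
  thus "(F has_derivative vd F p) (at p)" "Vector_Spaces.linear (*s) (*s) (vd F p)"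
    using D by auto
qed

lemma has_derivative_vec_nth':
  "(F has_derivative D) A \<Longrightarrow> ((\<lambda>z. (F z :: complex ^ 'm) $ i) has_derivative (\<lambda>v. D v $ i)) A"
  by (rule bounded_linear.has_derivative[OF bounded_linear_vec_nth])

lemma holomorphic_component:
  fixes F :: "complex ^ 'n \<Rightarrow> complex ^ 'm"
  assumes "holomorphic_map_on F U"
  shows "chol (\<lambda>z. F z $ i) U" "p \<in> U \<Longrightarrow> pd (\<lambda>z. F z $ i) v p = vd F p v $ i"
proof -
  show "chol (\<lambda>z. F z $ i) U"
    unfolding chol_def has_cderiv_def
  proof (intro ballI exI conjI allI)
    fix z assume z: "z \<in> U"
    show "((\<lambda>z. F z $ i) has_derivative (\<lambda>v. vd F z v $ i)) (at z)"
      by (rule has_derivative_vec_nth'[OF vdD(1)[OF assms z]])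
    show "vd F z (c *s v) $ i = c * vd F z v $ i" for c v
      by (simp add: vec_linear_simps[OF vdD(2)[OF assms z]])
  qed
  show "pd (\<lambda>z. F z $ i) v p = vd F p v $ i" if "p \<in> U"
    by (rule pd_eqI[OF has_derivative_vec_nth'[OF vdD(1)[OF assms that]]])
qed

lemma chol_vd:
  fixes F :: "complex ^ 'n \<Rightarrow> complex ^ 'm"
  assumes "holomorphic_map_on F U" "open U"
  shows "chol (\<lambda>p. vd F p v $ i) U"
proof -
  have "chol (pd (\<lambda>z. F z $ i) v) U"
    by (rule chol_pd[OF assms(2) holomorphic_component(1)[OF assms(1)]])
  thus ?thesis
    unfolding chol_def has_cderiv_def
    using holomorphic_component(2)[OF assms(1)]
      has_derivative_transform_within_open[OF _ assms(2)]
    by (metis (no_types, lifting))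
qed

lemma holomorphic_continuous_on:
  "holomorphic_map_on F U \<Longrightarrow> continuous_on U F"
  by (meson vdD(1) continuous_at_imp_continuous_on has_derivative_continuous)

text \<open>The point \<open>p\<close> is not tied to a leaf with directions \<open>range T\<close>,
  so the determinant is a holomorphic function on the whole domain of \<open>F\<close>.\<close>

definition jac :: "(complex ^ 'n \<Rightarrow> complex ^ 'm) \<Rightarrow> (complex ^ 'm \<Rightarrow> complex ^ 'n) \<Rightarrow> complex ^ 'n \<Rightarrow> complex ^ 'm ^ 'm" where
  "jac F T p = (\<chi> i j. vd F p (T (axis j 1)) $ i)"

lemma jac_mult:
  assumes "holomorphic_map_on F U" "p \<in> U" "Vector_Spaces.linear (*s) (*s) T"
  shows "jac F T p *v y = vd F p (T y)"
proof -
  have "Vector_Spaces.linear (*s) (*s) (vd F p \<circ> T)"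
    using vdD(2)[OF assms(1,2)] assms(3) by (rule Vector_Spaces.linear_compose[rotated])
  moreover have "jac F T p = matrix (vd F p \<circ> T)"
    by (simp add: jac_def matrix_def)
  ultimately show ?thesis
    by (metis comp_def matrix_works)
qed

lemma chol_det_jac:
  assumes "holomorphic_map_on F U" "open U"
  shows "chol (\<lambda>p. det (jac F T p)) U"
  by (rule chol_det) (simp add: jac_def chol_vd[OF assms])

lemma linear_vec_imp_bounded_linear:
  fixes T :: "complex ^ 'm \<Rightarrow> complex ^ 'n"
  assumes "Vector_Spaces.linear (*s) (*s) T"
  shows "bounded_linear T"
proof -
  have "linear T"
    by (rule linearI) (simp_all add: vec_linear_simps[OF assms] scaleR_eq_vec_scale)
  thus ?thesis by (simp add: linear_conv_bounded_linear)
qed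

lemma det_nonzero_iff_inj:
  fixes M :: "complex ^ 'm ^ 'm"
  shows "det M \<noteq> 0 \<longleftrightarrow> inj ((*v) M)"
  by (metis invertible_det_nz invertible_left_inverse matrix_left_invertible_injective)

lemma matrix_inv_left: "invertible A \<Longrightarrow> matrix_inv A ** A = mat 1"
  and matrix_inv_right: "invertible A \<Longrightarrow> A ** matrix_inv A = mat 1"
  unfolding invertible_def matrix_inv_def by (metis (mono_tags, lifting) someI_ex)+

text \<open>A leaf with linear coordinates: \<open>T\<close> identifies its direction space with
  \<open>complex ^ 'm\<close>, and \<open>F\<close> becomes a bijection between open sets of equal
  dimension.\<close>

locale slice =
  fixes F :: "complex ^ 'n \<Rightarrow> complex ^ 'm" and T :: "complex ^ 'm \<Rightarrow> complex ^ 'n" and a :: "complex ^ 'n"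
  assumes hol: "holomorphic_map_on F (ball 0 1)"
    and F_ball: "\<And>z. z \<in> ball 0 1 \<Longrightarrow> F z \<in> ball 0 1"
    and linT: "Vector_Spaces.linear (*s) (*s) T"
    and injT: "inj T"
    and bij: "bij_betw F (range (\<lambda>x. a + T x) \<inter> ball 0 1) (ball 0 1)"
begin

definition U where "U = {x. a + T x \<in> ball 0 1}"

definition f where "f x = F (a + T x)"

lemma cont_affine: "continuous_on A (\<lambda>x. a + T x)"
  using linear_vec_imp_bounded_linear[OF linT]
  by (intro continuous_intros bounded_linear.continuous_on[OF _ continuous_on_id])

lemma affine_has_derivative: "((\<lambda>x. a + T x) has_derivative T) (at x)"
  using has_derivative_add[OF has_derivative_const bounded_linear_imp_has_derivative[OF linear_vec_imp_bounded_linear[OF linT]]]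
  by simp

lemma open_U: "open U"
proof -
  have "U = (\<lambda>x. a + T x) -` ball 0 1" by (auto simp: U_def)
  thus ?thesis using open_vimage[OF open_ball cont_affine] by simp
qed

text \<open>Supplies the connectedness on which \<open>J_nonzero\<close> relies.\<close>

lemma convex_U: "convex U"
proof -
  have "linear T" using linear_vec_imp_bounded_linear[OF linT] by (simp add: linear_conv_bounded_linear)
  have "U = T -` ((\<lambda>z. - a + z) ` ball 0 1)"
    by (auto simp: U_def image_iff algebra_simps intro!: bexI[of _ "a + T _"])
  thus ?thesis
    using convex_linear_vimage[OF \<open>linear T\<close> convex_translation[OF convex_ball]] by metis
qed

lemma bij_f: "bij_betw f U (ball 0 1)"
proof -
  have "bij_betw (\<lambda>x. a + T x) U (range (\<lambda>x. a + T x) \<inter> ball 0 1)"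
    using injT by (auto simp: bij_betw_def U_def inj_on_def)
  from bij_betw_trans[OF this bij] show ?thesis
    by (simp add: f_def[abs_def] comp_def)
qed

lemma f_has_derivative:
  assumes "x \<in> U" shows "(f has_derivative (\<lambda>y. vd F (a + T x) (T y))) (at x)"
  unfolding f_def[abs_def]
  by (rule has_derivative_compose[OF affine_has_derivative vdD(1)[OF hol]]) (use assms in \<open>simp add: U_def\<close>)

lemma cont_f: "continuous_on U f"
  by (meson f_has_derivative continuous_at_imp_continuous_on has_derivative_continuous)

definition g where "g = inv_into U f"

lemma g: "y \<in> ball 0 1 \<Longrightarrow> g y \<in> U" "y \<in> ball 0 1 \<Longrightarrow> f (g y) = y" "x \<in> U \<Longrightarrow> g (f x) = x"
  using bij_f by (auto simp: g_def bij_betw_def inv_into_into f_inv_into_f)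

text \<open>Invariance of domain, as source and target have equal dimension.\<close>

lemma cont_g: "continuous_on (ball 0 1) g"
  using continuous_on_inverse_open[OF open_U cont_f, of g] g bij_f by (simp add: bij_betw_def)

abbreviation J where "J p \<equiv> det (jac F T p)"

lemma jac_eq: "p \<in> ball 0 1 \<Longrightarrow> jac F T p *v y = vd F p (T y)"
  by (rule jac_mult[OF hol _ linT])

lemma J_nonzero_iff: "p \<in> ball 0 1 \<Longrightarrow> J p \<noteq> 0 \<longleftrightarrow> inj (\<lambda>y. vd F p (T y))"
  using jac_eq[of p] by (simp add: det_nonzero_iff_inj inj_def)

text \<open>Otherwise Sard's theorem would make the image of \<open>f\<close> negligible, but that
  image is a ball.\<close>

lemma ex_J_nonzero: "\<exists>x\<in>U. J (a + T x) \<noteq> 0"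
proof (rule ccontr)
  assume "\<not> ?thesis"
  hence "negligible (f ` U)"
    by (intro sard_complex[OF f_has_derivative]) (use J_nonzero_iff in \<open>auto simp: U_def\<close>)
  hence "negligible (ball (0 :: complex ^ 'm) 1)" using bij_f by (simp add: bij_betw_def)
  thus False using open_not_negligible[of "ball (0 :: complex ^ 'm) 1"] by simp
qed

lemma schwarz_upper:
  assumes p: "p \<in> ball 0 1" shows "kap (F p) (vd F p v) \<le> kap p v"
proof (rule schwarz_pick_rado[where h = "\<lambda>_. 1"])
  show "continuous_on (ball 0 1) F" by (rule holomorphic_continuous_on[OF hol])
  show "\<exists>D. (F has_derivative D) (at z) \<and> Vector_Spaces.linear (*s) (*s) D" if "z \<in> ball 0 1" for z
    using vdD[OF hol that] by blast
  show "\<exists>D. has_cderiv (\<lambda>_. 1) D z" for z :: "complex ^ 'n"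
    using chol_const[of 1 UNIV] unfolding chol_def by blast
qed (use p F_ball vdD[OF hol p] in auto)

lemma g_has_derivative:
  assumes y: "y \<in> ball 0 1" and "J (a + T (g y)) \<noteq> 0"
  shows "(g has_derivative (*v) (matrix_inv (jac F T (a + T (g y))))) (at y)"
proof -
  define M where "M = jac F T (a + T (g y))"
  have gy: "g y \<in> U" by (rule g(1)[OF y])
  have p: "a + T (g y) \<in> ball 0 1" using gy by (simp add: U_def)
  have "invertible M" using assms(2) by (simp add: M_def invertible_det_nz)
  show ?thesis
    unfolding M_def[symmetric]
  proof (rule has_derivative_inverse_basic[where f = f and f' = "(*v) M" and T = "ball 0 1"])
    show "(f has_derivative (*v) M) (at (g y))"
    proof -
      have "(*v) M = (\<lambda>u. vd F (a + T (g y)) (T u))"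
        by (simp add: fun_eq_iff M_def jac_eq[OF p])
      thus ?thesis using f_has_derivative[OF gy] by simp
    qed
    show "bounded_linear ((*v) (matrix_inv M))"
      by (rule linear_vec_imp_bounded_linear) (rule matrix_vector_mul_linear_gen)
    show "(*v) (matrix_inv M) \<circ> (*v) M = id"
      using matrix_inv_left[OF \<open>invertible M\<close>] by (simp add: fun_eq_iff matrix_vector_mul_assoc)
    show "continuous (at y) g"
      using cont_g y by (simp add: continuous_on_eq_continuous_at)
  qed (use y g in auto)
qed

text \<open>
  The inverse \<open>g\<close> is only known to be continuous. It is holomorphic where \<open>J\<close> does not vanish along it,
  which suffices for the Schwarz--Pick inequality above.
\<close>

lemma schwarz_lower:
  assumes x: "x \<in> U" and Jx: "J (a + T x) \<noteq> 0"
  shows "kap (a + T x) (T v) \<le> kap (f x) (vd F (a + T x) (T v))"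
proof -
  define P where "P = f x"
  have P: "P \<in> ball 0 1" using bij_f x by (auto simp: P_def bij_betw_def)
  have gP: "g P = x" using g(3)[OF x] by (simp add: P_def)
  \<comment> \<open>The inverse of \<open>f\<close> as a map into the larger ball, and the Jacobian
    along it, whose zeros are the exceptional set in \<open>schwarz_pick_rado\<close>.\<close>
  define H where "H = (\<lambda>y. a + T (g y))"
  define h where "h = (\<lambda>y. J (H y))"
  have Hb: "H y \<in> ball 0 1" if "y \<in> ball 0 1" for y
    using g(1)[OF that] by (simp add: U_def H_def)
  have cH: "continuous_on (ball 0 1) H"
    unfolding H_def by (rule continuous_on_compose2[OF cont_affine cont_g]) auto
  have cJ: "chol J (ball 0 1)" by (rule chol_det_jac[OF hol open_ball])
  have dH: "(H has_derivative (\<lambda>u. T (matrix_inv (jac F T (H y)) *v u))) (at y)"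
     "Vector_Spaces.linear (*s) (*s) (\<lambda>u. T (matrix_inv (jac F T (H y)) *v u))"
    if "y \<in> ball 0 1" "h y \<noteq> 0" for y
  proof -
    show "(H has_derivative (\<lambda>u. T (matrix_inv (jac F T (H y)) *v u))) (at y)"
      using has_derivative_compose[OF g_has_derivative[OF that(1)] affine_has_derivative] that(2)
      by (simp add: h_def H_def)
    show "Vector_Spaces.linear (*s) (*s) (\<lambda>u. T (matrix_inv (jac F T (H y)) *v u))"
      using Vector_Spaces.linear_compose[OF matrix_vector_mul_linear_gen linT] by (simp add: comp_def)
  qed
  have hP: "h P \<noteq> 0" using Jx by (simp add: h_def H_def gP)
  have "kap (H P) (T (matrix_inv (jac F T (H P)) *v (vd F (a + T x) (T v)))) \<le> kap P (vd F (a + T x) (T v))"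
  proof (rule schwarz_pick_rado[where h = h, OF P cH _ Hb])
    show "continuous_on (ball 0 1) h"
      unfolding h_def by (rule continuous_on_compose2[OF chol_continuous_on[OF cJ] cH]) (use Hb in auto)
    show "\<exists>D. (H has_derivative D) (at z) \<and> Vector_Spaces.linear (*s) (*s) D" if "z \<in> ball 0 1" "h z \<noteq> 0" for z
      using dH[OF that] by blast
    show "\<exists>D. has_cderiv h D z" if z: "z \<in> ball 0 1" "h z \<noteq> 0" for z
    proof (intro exI)
      show "has_cderiv h (\<lambda>u. pd J (T (matrix_inv (jac F T (H z)) *v u)) (H z)) z"
        unfolding has_cderiv_def h_def
        using has_derivative_compose[OF dH(1)[OF z] cholD(1)[OF cJ Hb[OF z(1)]]]
        by (simp add: vec_linear_simps(3)[OF dH(2)[OF z]] cholD(2)[OF cJ Hb[OF z(1)]])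
    qed
  qed (use dH[OF P hP] hP in auto)
  \<comment> \<open>The derivative of \<open>H\<close> at \<open>P\<close> undoes that of
    \<open>f\<close> at \<open>x\<close>, so the left side becomes the length of
    \<open>T v\<close>.\<close>
  moreover have "invertible (jac F T (a + T x))" using Jx by (simp add: invertible_det_nz)
  hence "matrix_inv (jac F T (a + T x)) *v (vd F (a + T x) (T v)) = v"
    using jac_eq[of "a + T x" v] x matrix_inv_left[of "jac F T (a + T x)"]
    by (simp add: U_def matrix_vector_mul_assoc flip: jac_eq)
  ultimately show ?thesis by (simp add: H_def P_def g(3)[OF x])
qed

text \<open>
  By \<open>schwarz_lower\<close> the derivative of \<open>f\<close> is locally bounded below where it is invertible, so the set of
  these points is closed.
\<close>

lemma J_nonzero:
  assumes "x \<in> U" shows "J (a + T x) \<noteq> 0"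
proof -
  define G where "G = {x \<in> U. J (a + T x) \<noteq> 0}"
  have cJ: "continuous_on U (\<lambda>x. J (a + T x))"
    by (rule continuous_on_compose2[OF chol_continuous_on[OF chol_det_jac[OF hol open_ball]] cont_affine])
       (auto simp: U_def)
  have "G = U \<inter> (\<lambda>x. J (a + T x)) -` (- {0})" by (auto simp: G_def)
  hence "open G" using continuous_open_preimage[OF cJ open_U, of "- {0}"] by (simp add: open_Compl)
  have cvd: "continuous_on U (\<lambda>x. vd F (a + T x) v)" for v
  proof -
    have "continuous_on U (\<lambda>x. \<chi> i. vd F (a + T x) v $ i)"
      by (intro continuous_on_vec_lambda
            continuous_on_compose2[OF chol_continuous_on[OF chol_vd[OF hol open_ball]] cont_affine])
         (auto simp: U_def)
    thus ?thesis by simp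
  qed
  have "closedin (top_of_set U) G"
    unfolding closedin_limpt
  proof (intro conjI allI impI)
    show "G \<subseteq> U" by (auto simp: G_def)
    fix x assume "x islimpt G \<and> x \<in> U"
    hence xU: "x \<in> U" and "x islimpt G" by auto
    then obtain s where s: "\<And>n::nat. s n \<in> G" "s \<longlonglongrightarrow> x"
      unfolding islimpt_sequential by blast
    have sU: "s n \<in> U" for n using s by (auto simp: G_def)
    have "inj (\<lambda>y. vd F (a + T x) (T y))"
    proof -
      \<comment> \<open>At the points \<open>s n\<close> of \<open>G\<close> this follows from
        \<open>kap_ge\<close>, \<open>schwarz_lower\<close> and \<open>kap_le\<close> in turn. Both
        factors on the right are continuous, so it passes to the limit.\<close>
      have bound: "(norm (T y))\<^sup>2 \<le> (norm (vd F (a + T x) (T y)))\<^sup>2 / (1 - (norm (f x))\<^sup>2)\<^sup>2" for y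
      proof (rule LIMSEQ_le_const)
        have f1: "norm (f x) < 1" using bij_f xU by (auto simp: bij_betw_def)
        hence "(norm (f x))\<^sup>2 < 1" by (simp add: power_less_one_iff)
        moreover have "(\<lambda>n. f (s n)) \<longlonglongrightarrow> f x"
          using continuous_on_sequentially sU xU s(2) cont_f unfolding continuous_on_sequentially comp_def by blast
        moreover have "(\<lambda>n. vd F (a + T (s n)) (T y)) \<longlonglongrightarrow> vd F (a + T x) (T y)"
          using sU xU s(2) cvd[of "T y"] unfolding continuous_on_sequentially comp_def by blast
        ultimately show "(\<lambda>n. (norm (vd F (a + T (s n)) (T y)))\<^sup>2 / (1 - (norm (f (s n)))\<^sup>2)\<^sup>2) \<longlonglongrightarrow>
             (norm (vd F (a + T x) (T y)))\<^sup>2 / (1 - (norm (f x))\<^sup>2)\<^sup>2"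
          by (intro tendsto_intros) auto
        have "(norm (T y))\<^sup>2 \<le> (norm (vd F (a + T (s n)) (T y)))\<^sup>2 / (1 - (norm (f (s n)))\<^sup>2)\<^sup>2" for n
        proof -
          have "a + T (s n) \<in> ball 0 1" "f (s n) \<in> ball 0 1"
            using sU[of n] bij_f by (auto simp: U_def bij_betw_def)
          thus ?thesis
            using kap_ge[of "a + T (s n)" "T y"] schwarz_lower[of "s n" y] kap_le[of "f (s n)" "vd F (a + T (s n)) (T y)"]
              s(1)[of n] by (simp add: G_def)
        qed
        thus "\<exists>N. \<forall>n\<ge>N. (norm (T y))\<^sup>2 \<le> (norm (vd F (a + T (s n)) (T y)))\<^sup>2 / (1 - (norm (f (s n)))\<^sup>2)\<^sup>2"
          by blast
      qed
      have p: "a + T x \<in> ball 0 1" using xU by (simp add: U_def)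
      show ?thesis
      proof (rule injI)
        fix y z assume eq: "vd F (a + T x) (T y) = vd F (a + T x) (T z)"
        have "vd F (a + T x) (T (y - z)) = 0"
          using eq by (simp add: vec_linear_simps[OF linT] vec_linear_simps[OF vdD(2)[OF hol p]])
        with bound[of "y - z"] have "T (y - z) = 0" by simp
        thus "y = z" using injT by (simp add: vec_linear_simps[OF linT] inj_def)
      qed
    qed
    thus "x \<in> G"
      using J_nonzero_iff[of "a + T x"] xU by (simp add: G_def U_def)
  qed
  moreover have "openin (top_of_set U) G"
    using \<open>open G\<close> open_U by (simp add: openin_open_eq) (auto simp: G_def)
  ultimately have "G = {} \<or> G = U"
    using convex_connected[OF convex_U] by (metis connected_clopen)
  moreover have "G \<noteq> {}" using ex_J_nonzero by (auto simp: G_def)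
  ultimately show ?thesis using assms by (auto simp: G_def)
qed

text \<open>In leaf directions the inverse of the restriction contracts as well, so both
  inequalities hold.\<close>

lemma kap_vd:
  assumes "p \<in> range (\<lambda>x. a + T x) \<inter> ball 0 1"
  shows "kap (F p) (vd F p (T v)) = kap p (T v)"
proof -
  obtain x where x: "p = a + T x" "x \<in> U" using assms by (auto simp: U_def)
  show ?thesis
    using schwarz_upper[of p "T v"] schwarz_lower[OF x(2) J_nonzero[OF x(2)], of v] assms
    by (intro antisym) (auto simp: x(1) f_def)
qed

text \<open>Since \<open>F\<close> is isometric along the leaf, the terms quadratic in
  \<open>R\<close> cancel; the remaining term is linear in \<open>R\<close> yet bounded, so its
  coefficient cannot be positive.\<close>

lemma vd_kernel:
  assumes p: "p \<in> range (\<lambda>x. a + T x) \<inter> ball 0 1"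
    and orth: "\<And>y. kap p (T y + \<tau>) = kap p (T y) + kap p \<tau>"
  shows "vd F p \<tau> = 0"
proof -
  have pb: "p \<in> ball 0 1" using p by simp
  obtain x where x: "p = a + T x" "x \<in> U" using p by (auto simp: U_def)
  note lin = vec_linear_simps[OF vdD(2)[OF hol pb]]
  define K where "K = kap (F p) (vd F p \<tau>)"
  have "invertible (jac F T p)" using J_nonzero[OF x(2)] by (simp add: x(1) invertible_det_nz)
  hence surj: "\<exists>y. vd F p (T y) = w" for w
    by (metis jac_eq[OF pb] matrix_inv_right matrix_vector_mul_assoc matrix_vector_mul_lid)
  \<comment> \<open>Compare both sides of \<open>schwarz_upper\<close> at \<open>T y + \<tau>\<close>, where \<open>T y\<close> has \<open>R\<close> times the image of \<open>\<tau>\<close>.\<close>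
  have "(2 * R + 1) * K \<le> kap p \<tau>" for R :: real
  proof -
    obtain y where y: "vd F p (T y) = of_real R *s vd F p \<tau>" using surj by blast
    have "vd F p (T y + \<tau>) = of_real (R + 1) *s vd F p \<tau>"
      by (simp only: lin y vec.scale_left_distrib of_real_add of_real_1 vec.scale_one)
    hence "(R + 1)\<^sup>2 * K = kap (F p) (vd F p (T y + \<tau>))"
      by (simp only: kap_scale K_def norm_of_real power2_abs)
    also have "\<dots> \<le> kap p (T y) + kap p \<tau>"
      using schwarz_upper[OF pb, of "T y + \<tau>"] orth by simp
    also have "kap p (T y) = R\<^sup>2 * K"
      using kap_vd[OF p, of y] by (simp add: y kap_scale K_def)
    finally show ?thesis by (simp add: algebra_simps power2_eq_square)
  qed
  note R = this
  have "K \<le> 0"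
  proof (rule ccontr)
    assume "\<not> K \<le> 0"
    thus False using R[of "kap p \<tau> / K"] kap_nonneg[OF pb, of \<tau>] by (simp add: algebra_simps)
  qed
  hence "(norm (vd F p \<tau>))\<^sup>2 \<le> 0"
    using kap_ge[OF F_ball[OF pb], of "vd F p \<tau>"] unfolding K_def by linarith
  thus ?thesis by simp
qed

end

subsection \<open>The obstruction in one variable\<close>

text \<open>\<open>D 1 + \<i> * D \<i>\<close> is twice the coefficient of the antilinear part of \<open>D\<close>.\<close>

lemma wirtinger_zero:
  assumes F: "(F has_derivative D) (at a)" and G: "(G has_field_derivative d) (at a)"
    and "open U" "a \<in> U" "\<And>x. x \<in> U \<Longrightarrow> F x = G x"
  shows "D 1 + \<i> * D \<i> = 0"
proof -
  have "(F has_derivative (\<lambda>v. d * v)) (at a)"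
    using G[unfolded has_field_derivative_def]
    by (rule has_derivative_transform_within_open[of _ _ _ _ U]) (use assms in auto)
  hence "D = (\<lambda>v. d * v)" by (rule has_derivative_unique[OF F])
  thus ?thesis by (simp add: mult.left_commute[of \<i>])
qed

text \<open>
  The identities \<open>M\<close> and \<open>N\<close> in the proof arise from the assumption by applying the antiholomorphic
  Wirtinger derivative once and twice; \<open>D\<close> is the derivative of \<open>N\<close> at \<open>0\<close>.
\<close>

lemma no_holomorphic_solution:
  fixes S g :: "complex \<Rightarrow> complex"
  assumes r: "0 < r" "r \<le> 1" and S: "S holomorphic_on ball 0 r" and g: "g holomorphic_on ball 0 r"
    and S0: "S 0 = 0"
    and eq: "\<And>a. a \<in> ball 0 r \<Longrightarrow>
      g a = (1 - a * cnj a) * cnj (S a) * deriv S a - cnj a * (S a * cnj (S a)) - cnj a / (1 - a * cnj a)"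
  shows False
proof -
  define p where "p = deriv S"
  define q where "q = deriv p"
  have dS: "(S has_field_derivative p a) (at a)" if "a \<in> ball 0 r" for a
    unfolding p_def using holomorphic_derivI[OF S _ that] by auto
  have p: "p holomorphic_on ball 0 r"
    unfolding p_def by (intro holomorphic_deriv S open_ball)
  have dp: "(p has_field_derivative q a) (at a)" if "a \<in> ball 0 r" for a
    unfolding q_def using holomorphic_derivI[OF p _ that] by auto
  have q: "q holomorphic_on ball 0 r"
    unfolding q_def by (intro holomorphic_deriv p open_ball)
  define s where "s = deriv q"
  have dq: "(q has_field_derivative s a) (at a)" if "a \<in> ball 0 r" for a
    unfolding s_def using holomorphic_derivI[OF q _ that] by auto
  have nz: "1 - a * cnj a \<noteq> 0" if "a \<in> ball 0 r" for a
  proof -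
    have "cmod a < 1" using that r by simp
    hence "cmod (a * cnj a) < 1"
      by (simp add: norm_mult) (metis abs_square_less_1 abs_norm_cancel power2_eq_square)
    thus ?thesis by force
  qed
  have M: "(1 - a * cnj a) * (p a * cnj (p a)) - a * cnj (S a) * p a - cnj a * S a * cnj (p a)
             - S a * cnj (S a) = 1 / (1 - a * cnj a)\<^sup>2" if a: "a \<in> ball 0 r" for a
  proof -
    note [derivative_intros] = dS[OF a, unfolded has_field_derivative_def]
      dp[OF a, unfolded has_field_derivative_def]
    \<comment> \<open>In \<open>D 1 + \<i> * D \<i>\<close> the terms with \<open>v\<close> cancel
      and those with \<open>cnj v\<close> double. As \<open>g\<close> is holomorphic, it drops
      out.\<close>
    define D where "D = (\<lambda>v. - (v * cnj a + a * cnj v) * cnj (S a) * p a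
       + (1 - a * cnj a) * (cnj (p a * v) * p a + cnj (S a) * (q a * v))
       - (cnj v * (S a * cnj (S a)) + cnj a * (p a * v * cnj (S a) + S a * cnj (p a * v)))
       - (cnj v * (1 - a * cnj a) + cnj a * (v * cnj a + a * cnj v)) / (1 - a * cnj a)\<^sup>2)"
    have "((\<lambda>a. (1 - a * cnj a) * cnj (S a) * p a - cnj a * (S a * cnj (S a)) - cnj a / (1 - a * cnj a))
            has_derivative D) (at a)"
      unfolding D_def
      by (rule derivative_eq_intros refl nz[OF a] | simp only:)+
         (use nz[OF a] in \<open>auto simp: fun_eq_iff power2_eq_square divide_simps, simp_all add: algebra_simps\<close>)
    moreover have "(g has_field_derivative deriv g a) (at a)"
      using holomorphic_derivI[OF g _ a] by auto
    ultimately have "D 1 + \<i> * D \<i> = 0"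
      by (rule wirtinger_zero[OF _ _ open_ball a]) (use eq in \<open>simp add: p_def\<close>)
    hence "2 * (- a * cnj (S a) * p a + (1 - a * cnj a) * cnj (p a) * p a - S a * cnj (S a) - cnj a * S a * cnj (p a)
         - ((1 - a * cnj a) + cnj a * a) / (1 - a * cnj a)\<^sup>2) = 0"
      unfolding D_def by (simp add: divide_inverse algebra_simps)
    thus ?thesis by (subst (asm) mult_eq_0_iff) (simp add: algebra_simps)
  qed
  have N: "(1 - a * cnj a) * p a * cnj (q a) - 2 * a * p a * cnj (p a) - 2 * S a * cnj (p a)
             - cnj a * S a * cnj (q a) = 2 * a / (1 - a * cnj a) ^ 3" if a: "a \<in> ball 0 r" for a
  proof -
    note [derivative_intros] = dS[OF a, unfolded has_field_derivative_def]
      dp[OF a, unfolded has_field_derivative_def]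
    define D where "D = (\<lambda>v. - (v * cnj a + a * cnj v) * (p a * cnj (p a))
       + (1 - a * cnj a) * (q a * v * cnj (p a) + p a * cnj (q a * v))
       - (v * cnj (S a) * p a + a * cnj (p a * v) * p a + a * cnj (S a) * (q a * v))
       - (cnj v * S a * cnj (p a) + cnj a * (p a * v) * cnj (p a) + cnj a * S a * cnj (q a * v))
       - (p a * v * cnj (S a) + S a * cnj (p a * v))
       - 2 * (v * cnj a + a * cnj v) / (1 - a * cnj a) ^ 3)"
    have "((\<lambda>a. (1 - a * cnj a) * (p a * cnj (p a)) - a * cnj (S a) * p a - cnj a * S a * cnj (p a)
             - S a * cnj (S a) - 1 / (1 - a * cnj a)\<^sup>2) has_derivative D) (at a)"
      unfolding D_def
      by (rule derivative_eq_intros refl | simp only: power_not_zero[OF nz[OF a]] not_False_eq_True)+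
         (use nz[OF a] in \<open>auto simp: fun_eq_iff eval_nat_numeral divide_simps, simp_all add: algebra_simps\<close>)
    \<comment> \<open>By \<open>M\<close> the function above vanishes on the disc, so it is compared
      with the constant 0.\<close>
    moreover have "((\<lambda>a. 0) has_field_derivative 0) (at a)"
      by simp
    ultimately have "D 1 + \<i> * D \<i> = 0"
      by (rule wirtinger_zero[OF _ _ open_ball a]) (use M in simp)
    hence "2 * ((1 - a * cnj a) * p a * cnj (q a) - 2 * a * p a * cnj (p a) - 2 * S a * cnj (p a)
             - cnj a * S a * cnj (q a) - 2 * a / (1 - a * cnj a) ^ 3) = 0"
      unfolding D_def by (simp add: divide_inverse algebra_simps)
    thus ?thesis by (subst (asm) mult_eq_0_iff) (simp add: algebra_simps)
  qed
  have 0: "0 \<in> ball 0 r" using r by simp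
  have p0: "p 0 * cnj (p 0) = 1" using M[OF 0] S0 by simp
  have q0: "q 0 = 0" using N[OF 0] p0 S0 by auto
  note [derivative_intros] = dS[OF 0, unfolded has_field_derivative_def]
    dp[OF 0, unfolded has_field_derivative_def] dq[OF 0, unfolded has_field_derivative_def]
  \<comment> \<open>As \<open>S 0 = 0\<close>, \<open>q 0 = 0\<close> and
    \<open>p 0 * cnj (p 0) = 1\<close>, three terms of \<open>N\<close> contribute
    \<open>- 2 * v\<close> each.\<close>
  define D where "D = (\<lambda>v. p 0 * cnj (s 0 * v) - 6 * v)"
  have "((\<lambda>a. (1 - a * cnj a) * p a * cnj (q a) - 2 * a * p a * cnj (p a) - 2 * S a * cnj (p a)
             - cnj a * S a * cnj (q a) - 2 * a / (1 - a * cnj a) ^ 3) has_derivative D) (at 0)"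
    unfolding D_def
    by (rule derivative_eq_intros refl | simp only: power_not_zero[OF nz[OF 0]] not_False_eq_True)+
       (use p0 in \<open>auto simp: fun_eq_iff S0 q0 algebra_simps\<close>)
  moreover have "((\<lambda>a. 0) has_derivative (\<lambda>v. 0)) (at (0 :: complex))"
    by simp
  hence "((\<lambda>a. (1 - a * cnj a) * p a * cnj (q a) - 2 * a * p a * cnj (p a) - 2 * S a * cnj (p a)
             - cnj a * S a * cnj (q a) - 2 * a / (1 - a * cnj a) ^ 3) has_derivative (\<lambda>v. 0)) (at 0)"
    by (rule has_derivative_transform_within_open[OF _ open_ball 0]) (use N in simp)
  ultimately have "D = (\<lambda>v. 0)"
    by (rule has_derivative_unique)
  hence "D 1 = 0" "D \<i> = 0" by simp_all
  \<comment> \<open>This combination cancels the antilinear part and leaves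
    \<open>-12\<close>.\<close>
  hence "D 1 - \<i> * D \<i> = 0" by simp
  thus False by (simp add: D_def algebra_simps)
qed

subsection \<open>Foliations by slices of hyperplanes\<close>

lemma vec_subspace_imp_subspace:
  assumes "vec.subspace (V :: (complex ^ 'n) set)" shows "subspace V"
  using assms by (auto simp: subspace_def vec.subspace_def scaleR_eq_vec_scale)

lemma subspace_herm: "vec.subspace {v. herm v N = 0}"
  by (simp add: vec.subspace_def herm_simps)

text \<open>A real normal vector is also a Hermitian one because \<open>V\<close> is closed under
  multiplication by \<open>\<i>\<close>; a dimension count gives equality.\<close>

lemma hyperplane_normal:
  fixes V :: "(complex ^ 'n) set"
  assumes V: "vec.subspace V" "vec.dim V = CARD('n) - 1"
  obtains N where "N \<noteq> 0" "V = {v. herm v N = 0}"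
proof -
  have pos: "CARD('n) > 0" by simp
  have "V \<noteq> UNIV" using V(2) pos vec_dim_card[where 'a = complex and 'n = 'n] by (metis diff_less less_irrefl zero_less_one)
  hence "span V \<noteq> UNIV" using vec_subspace_imp_subspace[OF V(1)] by (metis span_eq_iff)
  then obtain N where N: "N \<noteq> 0" "\<And>v. v \<in> V \<Longrightarrow> inner N v = 0"
    using span_not_UNIV_orthogonal[of V] by (metis span_base)
  have N': "inner v N = 0" if "v \<in> V" for v
    using N(2)[OF that] by (simp add: inner_commute)
  have "herm v N = 0" if "v \<in> V" for v
  proof -
    have "\<i> *s v \<in> V" using V(1) that by (simp add: vec.subspace_def)
    hence "Re (herm v N) = 0" "Re (herm (\<i> *s v) N) = 0"
      using N'[OF that] N'[of "\<i> *s v"] by (simp_all add: inner_eq_Re_herm)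
    thus ?thesis by (simp add: herm_simps complex_eq_iff)
  qed
  hence sub: "V \<subseteq> {v. herm v N = 0}" by blast
  have "vec.dim {v. herm v N = 0} \<noteq> CARD('n)"
  proof
    assume "vec.dim {v. herm v N = 0} = CARD('n)"
    hence "{v. herm v N = 0} = UNIV"
      using vec.subspace_dim_equal[OF subspace_herm vec.subspace_UNIV, of N] by (simp add: card_cart_basis)
    hence "herm N N = 0" by blast
    thus False using N(1) by (simp add: herm_self)
  qed
  moreover have "vec.dim {v. herm v N = 0} \<le> CARD('n)"
    using vec.dim_subset[of "{v. herm v N = 0}" UNIV] by (simp add: card_cart_basis)
  ultimately have "vec.dim {v. herm v N = 0} \<le> vec.dim V"
    using V(2) by linarith
  hence "V = {v. herm v N = 0}"
    by (rule vec.subspace_dim_equal[OF V(1) subspace_herm sub])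
  with N(1) that show ?thesis by blast
qed

lemma subspace_parametrization:
  fixes V :: "(complex ^ 'n) set"
  assumes V: "vec.subspace V" "vec.dim V = CARD('m)"
  obtains T :: "complex ^ 'm \<Rightarrow> complex ^ 'n" where
    "Vector_Spaces.linear (*s) (*s) T" "inj T" "range T = V"
proof -
  have "vec.dim (UNIV :: (complex ^ 'm) set) = vec.dim V"
    using V(2) by (simp only: vec_dim_card)
  from vec.subspace_isomorphism[OF vec.subspace_UNIV V(1) this] that show ?thesis by blast
qed

text \<open>Orthogonality in the Bergman metric at \<open>q\<close>: by \<open>1\<close> and
  \<open>2\<close> the Euclidean cross term, weighted by \<open>1 - (norm q)\<^sup>2\<close>,
  cancels the one from the products with \<open>q\<close>.\<close>

lemma kap_orthogonal:
  assumes "herm u N = 0"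
  shows "kap q (u + (N - herm N q *s q)) = kap q u + kap q (N - herm N q *s q)"
proof -
  define c where "c = herm N q"
  define \<tau> where "\<tau> = N - c *s q"
  have 1: "herm u \<tau> = - (cnj c * herm u q)"
    using assms by (simp add: \<tau>_def herm_simps)
  have 2: "herm \<tau> q = of_real (1 - (norm q)\<^sup>2) * c"
    by (simp add: \<tau>_def herm_simps herm_self c_def algebra_simps)
  have n: "(norm (u + \<tau>))\<^sup>2 = (norm u)\<^sup>2 + (norm \<tau>)\<^sup>2 + 2 * Re (herm u \<tau>)"
    by (simp add: power2_norm_eq_inner inner_add_left inner_add_right inner_commute flip: inner_eq_Re_herm)
  have m: "(cmod (x + y))\<^sup>2 = (cmod x)\<^sup>2 + (cmod y)\<^sup>2 + 2 * Re (x * cnj y)" for x y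
    unfolding cmod_power2 by (simp add: power2_eq_square algebra_simps)
  have "Re (herm u q * cnj (herm \<tau> q)) = - ((1 - (norm q)\<^sup>2) * Re (herm u \<tau>))"
    by (simp add: 1 2 algebra_simps)
  hence "(1 - (norm q)\<^sup>2) * (norm (u + \<tau>))\<^sup>2 + (cmod (herm (u + \<tau>) q))\<^sup>2
      = ((1 - (norm q)\<^sup>2) * (norm u)\<^sup>2 + (cmod (herm u q))\<^sup>2)
        + ((1 - (norm q)\<^sup>2) * (norm \<tau>)\<^sup>2 + (cmod (herm \<tau> q))\<^sup>2)"
    unfolding herm_add_left m n by (simp add: algebra_simps)
  thus ?thesis
    by (simp add: kap_def \<tau>_def[symmetric] c_def[symmetric] add_divide_distrib)
qed

context slice
begin

lemma vd_normal:
  assumes "range T = {v. herm v N = 0}" and q: "q \<in> range (\<lambda>x. a + T x) \<inter> ball 0 1"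
  shows "vd F q (N - herm N q *s q) = 0"
  by (rule vd_kernel[OF q kap_orthogonal]) (use assms(1) in auto)

end

text \<open>The leaves enter through the disc spanned by \<open>\<nu>\<close>. The scaling
  \<open>herm \<nu> N = 1\<close> expresses that they are transverse to \<open>\<nu>\<close>, hence
  graphs over its orthogonal complement.\<close>

lemma no_affine_foliation:
  fixes F :: "complex ^ 'n \<Rightarrow> complex ^ 'm" and T\<^sub>0 :: "complex ^ 'm \<Rightarrow> complex ^ 'n"
  assumes e: "norm e = 1" "herm e \<nu> = 0" and \<nu>: "norm \<nu> = 1"
    and T\<^sub>0: "slice F T\<^sub>0 0" "range T\<^sub>0 = {v. herm v \<nu> = 0}"
    and leaf: "\<And>\<alpha>. cmod \<alpha> < 1 \<Longrightarrow> \<exists>N T. herm \<nu> N = 1 \<and> slice F T (\<alpha> *s \<nu>) \<and> range T = {v. herm v N = 0}"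
  shows False
proof -
  interpret T\<^sub>0: slice F T\<^sub>0 0 by fact
  note hol = T\<^sub>0.hol
  define J where "J = (\<lambda>p. det (jac F T\<^sub>0 p))"
  have cJ: "chol J (ball 0 1)" unfolding J_def by (rule chol_det_jac[OF hol open_ball])
  have T00: "T\<^sub>0 0 = 0" by (rule vec_linear_simps(4)[OF T\<^sub>0.linT])
  have J0: "J 0 \<noteq> 0"
    using T\<^sub>0.J_nonzero[of 0] by (simp add: J_def T\<^sub>0.U_def T00)
  have "isCont J 0"
    using chol_continuous_on[OF cJ] by (simp add: continuous_on_eq_continuous_at)
  then obtain r1 where r1: "r1 > 0" "\<And>p. dist p 0 < r1 \<Longrightarrow> J p \<noteq> 0"
    using J0 continuous_at_avoid[of 0 J 0] by (auto simp: dist_commute)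
  define r where "r = min r1 1"
  have r: "0 < r" "r \<le> 1" using r1 by (auto simp: r_def)
  define B where "B = ball (0 :: complex ^ 'n) r"
  have B: "open B" "B \<subseteq> ball 0 1" "\<And>p. p \<in> B \<Longrightarrow> J p \<noteq> 0"
    using r1 by (auto simp: B_def r_def dist_commute)
  \<comment> \<open>Cramer's rule for the condition that \<open>T\<^sub>0 (x p) + \<nu>\<close> lies
    in the kernel of the derivative. Thus \<open>\<sigma>\<close> is \<open>T\<^sub>0 (x p)\<close>,
    and \<open>s\<close> is its component along \<open>e\<close>.\<close>
  define x where "x = (\<lambda>p. \<chi> k. det (\<chi> i j. if j = k then (- vd F p \<nu>) $ i else (jac F T\<^sub>0 p $ i) $ j) / J p)"
  define s where "s = (\<lambda>p. \<Sum>k\<in>UNIV. x p $ k * herm (T\<^sub>0 (axis k 1)) e)"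
  have cvd: "chol (\<lambda>p. vd F p v $ i) B" for v i
    by (rule chol_subset[OF chol_vd[OF hol open_ball] B(2)])
  have cx: "chol (\<lambda>p. x p $ k) B" for k
  proof -
    have "chol (\<lambda>p. if j = k then (- vd F p \<nu>) $ i else (jac F T\<^sub>0 p $ i) $ j) B" for i j
      by (cases "j = k") (simp_all add: jac_def chol_uminus cvd)
    hence "chol (\<lambda>p. det (\<chi> i j. if j = k then (- vd F p \<nu>) $ i else (jac F T\<^sub>0 p $ i) $ j) / J p) B"
      by (intro chol_divide chol_det chol_subset[OF cJ B(2)] B(3)) simp_all
    thus ?thesis by (simp add: x_def)
  qed
  have cs: "chol s B"
    unfolding s_def by (intro chol_sum chol_mult cx chol_const)
  \<comment> \<open>Where \<open>J\<close> is nonzero there is at most one kernel vector of the form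
    \<open>v + \<nu>\<close>, so \<open>s p\<close> can be read off from any such vector.\<close>
  have s_eq: "s p = herm v e" if p: "p \<in> B" and v: "herm v \<nu> = 0" and k: "vd F p (v + \<nu>) = 0" for p v
  proof -
    have pb: "p \<in> ball 0 1" using p B(2) by blast
    obtain y where y: "v = T\<^sub>0 y" using v T\<^sub>0(2) by blast
    have "vd F p v + vd F p \<nu> = 0"
      using k by (simp add: vec_linear_simps[OF vdD(2)[OF hol pb]])
    hence "jac F T\<^sub>0 p *v y = - vd F p \<nu>"
      by (simp add: T\<^sub>0.jac_eq[OF pb] y eq_neg_iff_add_eq_0)
    hence "y = x p"
      using cramer[of "jac F T\<^sub>0 p" y "- vd F p \<nu>"] B(3)[OF p] by (simp add: x_def J_def)
    have "herm v e = herm (T\<^sub>0 (\<Sum>k\<in>UNIV. y $ k *s axis k 1)) e"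
      by (simp add: y basis_expansion)
    also have "\<dots> = (\<Sum>k\<in>UNIV. y $ k * herm (T\<^sub>0 (axis k 1)) e)"
    proof -
      interpret lT: Vector_Spaces.linear "(*s)" "(*s)" T\<^sub>0 by (rule T\<^sub>0.linT)
      have "herm (\<Sum>k\<in>A. w k) e = (\<Sum>k\<in>A. herm (w k) e)" for A :: "'m set" and w
        by (induction A rule: infinite_finite_induct) (simp_all add: herm_simps)
      thus ?thesis by (simp add: lT.sum lT.scale herm_simps)
    qed
    finally show ?thesis by (simp add: s_def \<open>y = x p\<close>)
  qed
  have ee: "herm e e = 1" "herm \<nu> \<nu> = 1" using e \<nu> by (simp_all add: herm_self)
  have \<nu>e: "herm \<nu> e = 0" using e(2) cnj_herm[of e \<nu>] by simp
  \<comment> \<open>The line parametrised by \<open>z\<close> is the trace of the leaf through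
    \<open>\<alpha> *s \<nu>\<close> on the plane of \<open>e\<close> and \<open>\<nu>\<close>; the
    equation of the leaf gives the slope \<open>- herm e N\<close>.\<close>
  have key: "\<exists>\<beta>. \<forall>z. z *s e + (\<alpha> + \<beta> * z) *s \<nu> \<in> B \<longrightarrow> 1 - cnj \<alpha> * (\<alpha> + \<beta> * z) \<noteq> 0 \<longrightarrow>
      s (z *s e + (\<alpha> + \<beta> * z) *s \<nu>) * (1 - cnj \<alpha> * (\<alpha> + \<beta> * z)) = - (cnj \<beta> + cnj \<alpha> * z)"
    if \<alpha>: "cmod \<alpha> < 1" for \<alpha>
  proof -
    obtain N T where N: "herm \<nu> N = 1" and T: "slice F T (\<alpha> *s \<nu>)" "range T = {v. herm v N = 0}"
      using leaf[OF \<alpha>] by blast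
    interpret T: slice F T "\<alpha> *s \<nu>" by fact
    define \<beta> where "\<beta> = - herm e N"
    show ?thesis
    proof (intro exI[of _ \<beta>] allI impI)
      fix z
      define q where "q = z *s e + (\<alpha> + \<beta> * z) *s \<nu>"
      define \<kappa> where "\<kappa> = 1 - cnj \<alpha> * (\<alpha> + \<beta> * z)"
      assume "z *s e + (\<alpha> + \<beta> * z) *s \<nu> \<in> B" "1 - cnj \<alpha> * (\<alpha> + \<beta> * z) \<noteq> 0"
      hence q: "q \<in> B" and \<kappa>: "\<kappa> \<noteq> 0" by (simp_all add: q_def \<kappa>_def)
      have qN: "herm q N = \<alpha>"
        by (simp add: q_def herm_simps N \<beta>_def algebra_simps)
      hence Nq: "herm N q = cnj \<alpha>" using cnj_herm[of q N] by simp
      have "q - \<alpha> *s \<nu> \<in> range T" by (simp add: T(2) herm_simps qN N)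
      then obtain y where "T y = q - \<alpha> *s \<nu>" by force
      hence "q = \<alpha> *s \<nu> + T y" by simp
      hence "q \<in> range (\<lambda>x. \<alpha> *s \<nu> + T x) \<inter> ball 0 1" using q B(2) by blast
      from T.vd_normal[OF T(2) this] have 0: "vd F q (N - cnj \<alpha> *s q) = 0"
        by (simp only: Nq)
      have q\<nu>: "herm q \<nu> = \<alpha> + \<beta> * z" and qe: "herm q e = z"
        by (simp_all add: q_def herm_simps e ee \<nu>e)
      have N\<nu>: "herm N \<nu> = 1" using N cnj_herm[of \<nu> N] by simp
      have Ne: "herm N e = - cnj \<beta>" using cnj_herm[of e N] by (simp add: \<beta>_def)
      \<comment> \<open>\<open>\<kappa>\<close> is the component of the kernel vector along
        \<open>\<nu>\<close>; dividing by it normalises this component to 1.\<close>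
      define v where "v = (1 / \<kappa>) *s (N - cnj \<alpha> *s q) - \<nu>"
      have "herm v \<nu> = 0"
        unfolding v_def herm_simps N\<nu> q\<nu> ee \<kappa>_def[symmetric] using \<kappa> by simp
      moreover have "v + \<nu> = (1 / \<kappa>) *s (N - cnj \<alpha> *s q)" unfolding v_def by simp
      hence "vd F q (v + \<nu>) = 0"
        using 0 q B(2) vec_linear_simps(3)[OF vdD(2)[OF hol, of q]]
        by (metis subsetD vec.scale_zero_right)
      ultimately have "s q = herm v e" by (rule s_eq[OF q])
      also have "\<dots> = (- cnj \<beta> - cnj \<alpha> * z) / \<kappa>"
        by (simp add: v_def herm_simps Ne qe \<nu>e diff_divide_distrib)
      finally show "s (z *s e + (\<alpha> + \<beta> * z) *s \<nu>) * (1 - cnj \<alpha> * (\<alpha> + \<beta> * z)) = - (cnj \<beta> + cnj \<alpha> * z)"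
        using \<kappa> unfolding q_def[symmetric] \<kappa>_def[symmetric] by simp
    qed
  qed
  define S where "S = (\<lambda>w. s (w *s \<nu>))"
  define g where "g = (\<lambda>w. pd s e (w *s \<nu>))"
  have line: "w *s \<nu> \<in> B" if "w \<in> ball 0 r" for w
    using that by (simp add: B_def norm_vec_scale \<nu>)
  have dline: "((\<lambda>w. w *s \<nu>) has_derivative (\<lambda>h. h *s \<nu>)) (at w)" for w
    by (auto intro!: derivative_eq_intros)
  have dS: "(S has_field_derivative pd s \<nu> (w *s \<nu>)) (at w)" if "w \<in> ball 0 r" for w
    unfolding S_def by (rule chol_has_field_derivative[OF cs line[OF that] dline])
  have dg: "(g has_field_derivative pd (pd s e) \<nu> (w *s \<nu>)) (at w)" if "w \<in> ball 0 r" for w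
    unfolding g_def by (rule chol_has_field_derivative[OF chol_pd[OF B(1) cs] line[OF that] dline])
  \<comment> \<open>The value and the \<open>z\<close>-derivative of the identity in
    \<open>key\<close> at \<open>z = 0\<close>.\<close>
  have eqs: "S \<alpha> * (1 - \<alpha> * cnj \<alpha>) = - cnj \<beta> \<and>
      (g \<alpha> + \<beta> * deriv S \<alpha>) * (1 - \<alpha> * cnj \<alpha>) - S \<alpha> * (cnj \<alpha> * \<beta>) = - cnj \<alpha>"
    if \<alpha>: "\<alpha> \<in> ball 0 r" and \<beta>: "\<And>z. z *s e + (\<alpha> + \<beta> * z) *s \<nu> \<in> B \<Longrightarrow> 1 - cnj \<alpha> * (\<alpha> + \<beta> * z) \<noteq> 0 \<Longrightarrow>
      s (z *s e + (\<alpha> + \<beta> * z) *s \<nu>) * (1 - cnj \<alpha> * (\<alpha> + \<beta> * z)) = - (cnj \<beta> + cnj \<alpha> * z)" for \<alpha> \<beta>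
  proof
    have nz: "1 - cnj \<alpha> * \<alpha> \<noteq> 0"
      using one_minus_herm_nonzero[of "\<alpha> *s \<nu>" "\<alpha> *s \<nu>"] line[OF \<alpha>] B(2)
      by (auto simp: herm_simps ee mult.commute)
    show "S \<alpha> * (1 - \<alpha> * cnj \<alpha>) = - cnj \<beta>"
      using \<beta>[of 0] line[OF \<alpha>] nz by (simp add: S_def mult.commute)
    define l where "l = (\<lambda>z. z *s e + (\<alpha> + \<beta> * z) *s \<nu>)"
    have l0: "l 0 = \<alpha> *s \<nu>" by (simp add: l_def)
    have dl: "(l has_derivative (\<lambda>h. h *s (e + \<beta> *s \<nu>))) (at z)" for z
      unfolding l_def by (auto intro!: derivative_eq_intros simp: vec_eq_iff algebra_simps)
    have cl: "continuous_on UNIV l"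
      using dl by (meson continuous_at_imp_continuous_on has_derivative_continuous)
    \<comment> \<open>A neighbourhood of \<open>0\<close> on which the identity holds, so that its
      two sides have the same derivative at \<open>0\<close>.\<close>
    define O1 where "O1 = l -` B \<inter> (\<lambda>z. 1 - cnj \<alpha> * (\<alpha> + \<beta> * z)) -` (- {0})"
    have "open O1"
      unfolding O1_def
      by (intro open_Int open_vimage B(1) cl open_Compl closed_singleton continuous_intros)
    have "0 \<in> O1" using nz line[OF \<alpha>] by (simp add: O1_def l0)
    have dk: "((\<lambda>z. 1 - cnj \<alpha> * (\<alpha> + \<beta> * z)) has_field_derivative (- (cnj \<alpha> * \<beta>))) (at 0)"
      by (auto intro!: derivative_eq_intros)
    have "((\<lambda>z. s (l z)) has_field_derivative pd s (e + \<beta> *s \<nu>) (l 0)) (at 0)"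
      by (rule chol_has_field_derivative[OF cs _ dl]) (use line[OF \<alpha>] l0 in simp)
    moreover have "pd s (e + \<beta> *s \<nu>) (l 0) = g \<alpha> + \<beta> * deriv S \<alpha>"
      using pd_add[OF cs line[OF \<alpha>]] cholD(2)[OF cs line[OF \<alpha>]] DERIV_imp_deriv[OF dS[OF \<alpha>]]
      by (simp add: l0 g_def)
    ultimately have "((\<lambda>z. s (l z)) has_field_derivative (g \<alpha> + \<beta> * deriv S \<alpha>)) (at 0)" by simp
    from DERIV_mult[OF this dk]
    have "((\<lambda>z. s (l z) * (1 - cnj \<alpha> * (\<alpha> + \<beta> * z))) has_field_derivative
       ((g \<alpha> + \<beta> * deriv S \<alpha>) * (1 - \<alpha> * cnj \<alpha>) - S \<alpha> * (cnj \<alpha> * \<beta>))) (at 0)"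
      by (simp add: l0 S_def mult_ac)
    moreover have "((\<lambda>z. - (cnj \<beta> + cnj \<alpha> * z)) has_field_derivative (- cnj \<alpha>)) (at 0)"
      by (auto intro!: derivative_eq_intros)
    hence "((\<lambda>z. s (l z) * (1 - cnj \<alpha> * (\<alpha> + \<beta> * z))) has_field_derivative (- cnj \<alpha>)) (at 0)"
      by (rule has_field_derivative_transform_within_open[OF _ \<open>open O1\<close> \<open>0 \<in> O1\<close>])
         (use \<beta> in \<open>auto simp: O1_def l_def\<close>)
    ultimately show "(g \<alpha> + \<beta> * deriv S \<alpha>) * (1 - \<alpha> * cnj \<alpha>) - S \<alpha> * (cnj \<alpha> * \<beta>) = - cnj \<alpha>"
      by (rule DERIV_unique)
  qed
  show False
  proof (rule no_holomorphic_solution[OF r])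
    show "S holomorphic_on ball 0 r" "g holomorphic_on ball 0 r"
      using dS dg by (meson holomorphic_on_open open_ball)+
    \<comment> \<open>At the origin the Bergman normal is \<open>\<nu>\<close> itself, so
      \<open>\<sigma>\<close> vanishes there.\<close>
    have "vd F 0 (\<nu> - herm \<nu> 0 *s 0) = 0"
      by (rule T\<^sub>0.vd_normal[OF T\<^sub>0(2)]) (auto intro!: rev_image_eqI[of 0] simp: T00)
    hence "s 0 = herm 0 e"
      using r by (intro s_eq) (auto simp: B_def herm_simps)
    thus "S 0 = 0" by (simp add: S_def herm_simps)
    show "g \<alpha> = (1 - \<alpha> * cnj \<alpha>) * cnj (S \<alpha>) * deriv S \<alpha> - cnj \<alpha> * (S \<alpha> * cnj (S \<alpha>)) - cnj \<alpha> / (1 - \<alpha> * cnj \<alpha>)"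
      if \<alpha>: "\<alpha> \<in> ball 0 r" for \<alpha>
    proof -
      have "cmod \<alpha> < 1" using \<alpha> r by simp
      from key[OF this] obtain \<beta> where \<beta>: "\<And>z. z *s e + (\<alpha> + \<beta> * z) *s \<nu> \<in> B \<Longrightarrow> 1 - cnj \<alpha> * (\<alpha> + \<beta> * z) \<noteq> 0 \<Longrightarrow>
          s (z *s e + (\<alpha> + \<beta> * z) *s \<nu>) * (1 - cnj \<alpha> * (\<alpha> + \<beta> * z)) = - (cnj \<beta> + cnj \<alpha> * z)"
        by blast
      define t where "t = 1 - \<alpha> * cnj \<alpha>"
      have t: "t \<noteq> 0" "cnj t = t"
        using one_minus_herm_nonzero[of "\<alpha> *s \<nu>" "\<alpha> *s \<nu>"] line[OF \<alpha>] B(2)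
        by (auto simp: t_def herm_simps ee mult.commute)
      from eqs[OF \<alpha> \<beta>] have 1: "S \<alpha> * t = - cnj \<beta>"
        and 2: "(g \<alpha> + \<beta> * deriv S \<alpha>) * t - S \<alpha> * (cnj \<alpha> * \<beta>) = - cnj \<alpha>"
        by (auto simp: t_def)
      \<comment> \<open>As \<open>t\<close> is real, conjugating the first equation expresses
        \<open>\<beta>\<close> through \<open>S\<close>, which eliminates it from the
        second.\<close>
      have "\<beta> = - cnj (S \<alpha>) * t"
        using arg_cong[OF 1, of cnj] t(2) by simp
      with 2 have "t * g \<alpha> = t * (t * cnj (S \<alpha>) * deriv S \<alpha> - cnj \<alpha> * (S \<alpha> * cnj (S \<alpha>)) - cnj \<alpha> / t)"
        using t(1) by (simp add: algebra_simps)
      thus ?thesis using t(1) by (simp add: t_def[symmetric])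
    qed
  qed
qed

section \<open>Reduction of the theorem to the local obstruction\<close>

theorem theorem1p2:
  fixes S :: "complex set"
  assumes "CARD('n::finite) \<ge> 2"
    and "CARD('m::finite) = CARD('n) - 1"
    and "open S" and "connected S" and "S \<noteq> {}" and "bounded S"
  shows "\<not> (\<exists>f :: complex \<Rightarrow> (complex ^ 'n) set.
           (\<forall>t\<in>S. f t \<in> complex_affine_hyperplanes) \<and>
           (let W = (\<lambda>t. f t \<inter> ball 0 1) in
             ball 0 1 = (\<Union>t\<in>S. W t) \<and>
             (\<forall>s\<in>S. \<forall>t\<in>S. W t \<inter> W s = {} \<or> W s = W t) \<and>
             (\<exists>\<pi> :: complex ^ 'n \<Rightarrow> complex ^ 'm.
                holomorphic_map_on \<pi> (ball 0 1) \<and>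
                \<pi> ` ball 0 1 \<subseteq> ball 0 1 \<and>
                (\<forall>t\<in>S. bij_betw \<pi> (W t) (ball 0 1)))))"
proof
  assume "\<exists>f :: complex \<Rightarrow> (complex ^ 'n) set.
           (\<forall>t\<in>S. f t \<in> complex_affine_hyperplanes) \<and>
           (let W = (\<lambda>t. f t \<inter> ball 0 1) in
             ball 0 1 = (\<Union>t\<in>S. W t) \<and>
             (\<forall>s\<in>S. \<forall>t\<in>S. W t \<inter> W s = {} \<or> W s = W t) \<and>
             (\<exists>\<pi> :: complex ^ 'n \<Rightarrow> complex ^ 'm.
                holomorphic_map_on \<pi> (ball 0 1) \<and>
                \<pi> ` ball 0 1 \<subseteq> ball 0 1 \<and>
                (\<forall>t\<in>S. bij_betw \<pi> (W t) (ball 0 1))))"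
  then obtain f :: "complex \<Rightarrow> (complex ^ 'n) set" where F:
    "(\<forall>t\<in>S. f t \<in> complex_affine_hyperplanes) \<and>
       ball 0 1 = (\<Union>t\<in>S. f t \<inter> ball 0 1) \<and>
       (\<forall>s\<in>S. \<forall>t\<in>S. f t \<inter> ball 0 1 \<inter> (f s \<inter> ball 0 1) = {} \<or> f s \<inter> ball 0 1 = f t \<inter> ball 0 1) \<and>
       (\<exists>\<pi> :: complex ^ 'n \<Rightarrow> complex ^ 'm.
          holomorphic_map_on \<pi> (ball 0 1) \<and> \<pi> ` ball 0 1 \<subseteq> ball 0 1 \<and>
          (\<forall>t\<in>S. bij_betw \<pi> (f t \<inter> ball 0 1) (ball 0 1)))"
    unfolding Let_def by (rule exE)
  have f: "f t \<in> complex_affine_hyperplanes" if "t \<in> S" for t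
    using F that by (elim conjE) (rule bspec)
  have cover: "ball 0 1 = (\<Union>t\<in>S. f t \<inter> ball 0 1)"
    using F by (elim conjE)
  have disj: "f t \<inter> ball 0 1 \<inter> (f s \<inter> ball 0 1) = {} \<or> f s \<inter> ball 0 1 = f t \<inter> ball 0 1"
    if "s \<in> S" "t \<in> S" for s t
    using F[THEN conjunct2, THEN conjunct2, THEN conjunct1] that by blast
  obtain \<pi> :: "complex ^ 'n \<Rightarrow> complex ^ 'm" where P:
    "holomorphic_map_on \<pi> (ball 0 1) \<and> \<pi> ` ball 0 1 \<subseteq> ball 0 1 \<and>
       (\<forall>t\<in>S. bij_betw \<pi> (f t \<inter> ball 0 1) (ball 0 1))"
    using F[THEN conjunct2, THEN conjunct2, THEN conjunct2] by (rule exE)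
  have hol: "holomorphic_map_on \<pi> (ball 0 1)" and \<pi>_ball: "\<pi> ` ball 0 1 \<subseteq> ball 0 1"
    using P by simp_all
  have bij: "bij_betw \<pi> (f t \<inter> ball 0 1) (ball 0 1)" if "t \<in> S" for t
    using P that by simp
  \<comment> \<open>The base point is moved from \<open>a\<close> to the given \<open>p\<close>, so
    that leaves can be based at the points \<open>\<alpha> *s \<nu>\<close>.\<close>
  have leaf: "\<exists>N T. N \<noteq> 0 \<and> slice \<pi> T p \<and> range T = {v. herm v N = 0} \<and> f t = {q. herm (q - p) N = 0}"
    if t: "t \<in> S" "p \<in> f t" for t p
  proof -
    obtain a V where V: "f t = (\<lambda>v. a + v) ` V" "vec.subspace V" "vec.dim V = CARD('n) - 1"
      using f[OF t(1)] unfolding complex_affine_hyperplanes_def by blast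
    obtain N where N: "N \<noteq> 0" "V = {v. herm v N = 0}" by (rule hyperplane_normal[OF V(2,3)])
    have "vec.dim V = CARD('m)" using V(3) assms(2) by simp
    then obtain T :: "complex ^ 'm \<Rightarrow> complex ^ 'n" where
      T: "Vector_Spaces.linear (*s) (*s) T" "inj T" "range T = V"
      by (rule subspace_parametrization[OF V(2)])
    have ft: "f t = {q. herm (q - p) N = 0}"
    proof -
      have "herm (p - a) N = 0" using t(2) V(1) N(2) by auto
      hence "herm p N = herm a N" by (simp add: herm_simps)
      moreover have "f t = {q. herm (q - a) N = 0}"
        unfolding V(1) N(2) by (force simp: image_iff intro: exI[of _ "_ - a"])
      ultimately show ?thesis by (simp add: herm_simps)
    qed
    have "range (\<lambda>x. p + T x) = (\<lambda>v. p + v) ` V" using T(3) by (metis image_image)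
    also have "\<dots> = f t"
      unfolding ft N(2) by (force simp: image_iff intro: exI[of _ "_ - p"])
    finally have "range (\<lambda>x. p + T x) = f t" .
    moreover have "\<pi> z \<in> ball 0 1" if "z \<in> ball 0 1" for z using \<pi>_ball that by blast
    ultimately have "slice \<pi> T p"
      using slice.intro[OF hol _ T(1,2), of p] bij[OF t(1)] by simp
    thus ?thesis using N(1) T(3) N(2) ft by blast
  qed
  have "0 \<in> (\<Union>t\<in>S. f t \<inter> ball 0 1)" unfolding cover[symmetric] by simp
  then obtain t0 where t0: "t0 \<in> S" "0 \<in> f t0" by blast
  obtain N0 T0 where N0: "N0 \<noteq> 0" "slice \<pi> T0 0" "range T0 = {v. herm v N0 = 0}" "f t0 = {q. herm (q - 0) N0 = 0}"
    using leaf[OF t0] by blast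
  define \<nu> where "\<nu> = (1 / of_real (norm N0)) *s N0"
  have \<nu>: "norm \<nu> = 1" using N0(1) by (simp add: \<nu>_def norm_vec_scale norm_divide)
  have herm_\<nu>: "herm v \<nu> = 0 \<longleftrightarrow> herm v N0 = 0" for v
    using N0(1) by (simp add: \<nu>_def herm_simps)
  have \<nu>\<nu>: "herm \<nu> \<nu> = 1" by (simp add: herm_self \<nu>)
  obtain y :: "complex ^ 'm" where "y \<noteq> 0" using one_neq_zero by blast
  define e where "e = (1 / of_real (norm (T0 y))) *s T0 y"
  interpret T0: slice \<pi> T0 0 by fact
  have "T0 y \<noteq> 0"
    using \<open>y \<noteq> 0\<close> T0.injT vec_linear_simps(4)[OF T0.linT] by (metis injD)
  hence e: "norm e = 1" "herm e \<nu> = 0"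
    using N0(3) by (auto simp: e_def norm_vec_scale norm_divide herm_simps herm_\<nu>)
  show False
  proof (rule no_affine_foliation[OF e \<nu> N0(2)])
    show rT0: "range T0 = {v. herm v \<nu> = 0}" using N0(3) herm_\<nu> by auto
    show "\<exists>N T. herm \<nu> N = 1 \<and> slice \<pi> T (\<alpha> *s \<nu>) \<and> range T = {v. herm v N = 0}"
      if \<alpha>: "cmod \<alpha> < 1" for \<alpha>
    proof (cases "\<alpha> = 0")
      case True
      thus ?thesis using N0(2) rT0 \<nu>\<nu> by auto
    next
      case False
      have ab: "\<alpha> *s \<nu> \<in> ball 0 1" using \<alpha> by (simp add: norm_vec_scale \<nu>)
      then obtain t where t: "t \<in> S" "\<alpha> *s \<nu> \<in> f t" using cover by blast
      obtain N T where N: "slice \<pi> T (\<alpha> *s \<nu>)" "range T = {v. herm v N = 0}"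
        "f t = {q. herm (q - \<alpha> *s \<nu>) N = 0}"
        using leaf[OF t] by blast
      \<comment> \<open>If \<open>\<nu>\<close> were a direction of this leaf, the leaf would
        contain \<open>0\<close> and so agree in the ball with the leaf through \<open>0\<close>, to
        which \<open>\<alpha> *s \<nu>\<close> does not belong.\<close>
      have nz: "herm \<nu> N \<noteq> 0"
      proof
        assume "herm \<nu> N = 0"
        hence "0 \<in> f t" by (simp add: N(3) herm_simps)
        hence "f t0 \<inter> ball 0 1 = f t \<inter> ball 0 1"
          using disj[OF t0(1) t(1)] t0(2) by auto
        hence "\<alpha> *s \<nu> \<in> f t0" using t(2) ab by blast
        hence "herm (\<alpha> *s \<nu>) \<nu> = 0" using N0(4) herm_\<nu> by simp
        thus False using False \<nu>\<nu> by (simp add: herm_simps)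
      qed
      \<comment> \<open>The conjugate compensates for the antilinearity of \<open>herm\<close> in
        its second argument.\<close>
      define N' where "N' = (1 / cnj (herm \<nu> N)) *s N"
      have "herm v N' = herm v N / herm \<nu> N" for v by (simp add: N'_def herm_simps)
      hence "herm \<nu> N' = 1" "range T = {v. herm v N' = 0}" using nz N(2) by auto
      thus ?thesis using N(1) by blast
    qed
  qed
qed

end
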